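(* Let $f$ be a proper convex function on $\mathbb{R}^n$ that promotes the structure of $\bm{x}\in\mathbb{R}^n$, $\bm{x}\neq\bm{0}$, and let $\bm{g}\in\mathbb{R}^n$ be a standard i.i.d. Gaussian vector. Suppose that the subdifferential $\partial f(\bm{x})$ satisfies $$\exists\,\bm{z}_0\quad\text{s.t.}\quad \langle \bm{z}-\bm{z}_0,\bm{z}_0\rangle=0\qquad\forall\,\bm{z}\in\partial f(\bm{x})$$ (here $\bm{z}_0\in\mathbb{R}^n$ is not required to belong to $\partial f(\bm{x})$). Then for any positive values of $\lambda,\zeta$, $$0\le E_\delta\le (4\lambda\beta+\gamma)\,\omega\big(\mathcal{D}(f,\bm{x})\cap\mathbb{B}^n\big)+\gamma(\zeta+2\lambda\beta)+4\lambda^2\beta^2,$$ and $$0\le \inf_{t\ge 0}\mathbb{E}\,\mathrm{dist}(\bm{g},t\,\partial f(\bm{x}))-\omega\big(\mathcal{D}(f,\bm{x})\cap\mathbb{B}^n\big)\le 1.6+4\beta,$$ where $\gamma$ is the constant $$\gamma=\sqrt{72}\,\sqrt{\ln\frac{3}{1-4e^{-\lambda^2/2}-2e^{-\zeta^2/2}}},$$ and $\beta$ is given by $$\beta=\frac{\|\bm{z}_1\|_2}{\|\bm{z}_0\|_2},\qquad \bm{z}_1=\arg\min_{\bm{z}\in\partial f(\bm{x})}\|\bm{z}\|_2.$$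
   Context: $\|\cdot\|_2$ is the Euclidean norm, $\mathbb{B}^n$ is the closed Euclidean unit ball of $\mathbb{R}^n$, and $\mathrm{dist}(\bm{g},C)=\inf_{\bm{z}\in C}\|\bm{g}-\bm{z}\|_2$. The descent cone of $f$ at $\bm{x}$ is $\mathcal{D}(f,\bm{x})=\bigcup_{t>0}\{\bm{z}\in\mathbb{R}^n: f(\bm{x}+t\bm{z})\le f(\bm{x})\}$. Also $\mathrm{cone}(\partial f(\bm{x}))=\bigcup_{t\ge0}t\,\partial f(\bm{x})$. The Gaussian width of a set $C\subseteq\mathbb{R}^n$ is $\omega(C)=\mathbb{E}\sup_{\bm{y}\in C}\langle\bm{y},\bm{g}\rangle$ with $\bm{g}$ standard Gaussian in $\mathbb{R}^n$. The statistical dimension of the descent cone is $\delta(\mathcal{D}(f,\bm{x}))=\mathbb{E}\,\mathrm{dist}^2(\bm{g},\mathrm{cone}(\partial f(\bm{x})))$; its standard upper bound is $U_\delta=\inf_{t\ge0}\mathbb{E}\,\mathrm{dist}^2(\bm{g},t\,\partial f(\bm{x}))$; and the error is $E_\delta=U_\delta-\delta(\mathcal{D}(f,\bm{x}))$. The phrase "promotes the structure of $\bm{x}$" is informal: $f$ is a convex penalty (such as the $\ell_1$ norm for sparse vectors) used to recover $\bm{x}$ having a given low-dimensional structure. *)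

theory Defs
  imports "HOL-Probability.Probability"
begin

definition proper_fun :: "('a \<Rightarrow> ereal) \<Rightarrow> bool" where
  "proper_fun f \<longleftrightarrow> (\<forall>x. f x \<noteq> -\<infinity>) \<and> (\<exists>x. f x \<noteq> \<infinity>)"

text \<open>The library's \<open>convex_on\<close> needs a codomain that is a real vector space, which \<^typ>\<open>ereal\<close>
  is not. For proper \<open>f\<close> no sum below involves \<open>-\<infinity>\<close>.\<close>

definition convex_fun :: "('a::real_vector \<Rightarrow> ereal) \<Rightarrow> bool" where
  "convex_fun f \<longleftrightarrow> (\<forall>x y. \<forall>u v. 0 < u \<longrightarrow> 0 < v \<longrightarrow> u + v = 1 \<longrightarrow>
     f (u *\<^sub>R x + v *\<^sub>R y) \<le> ereal u * f x + ereal v * f y)"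

text \<open>For proper \<open>f\<close> this set is empty at every point with \<open>f x = \<infinity>\<close>.\<close>

definition subdifferential :: "('a::real_inner \<Rightarrow> ereal) \<Rightarrow> 'a \<Rightarrow> 'a set" where
  "subdifferential f x = {z. \<forall>y. f x + ereal (z \<bullet> (y - x)) \<le> f y}"

definition descent_cone :: "('a::real_vector \<Rightarrow> ereal) \<Rightarrow> 'a \<Rightarrow> 'a set" where
  "descent_cone f x = (\<Union>t\<in>{0<..}. {z. f (x + t *\<^sub>R z) \<le> f x})"

definition cone_of :: "'a::real_vector set \<Rightarrow> 'a set" where
  "cone_of S = (\<Union>t\<in>{0..}. (*\<^sub>R) t ` S)"

definition std_gaussian_vector :: "'w measure \<Rightarrow> ('w \<Rightarrow> real ^ 'n) \<Rightarrow> bool" where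
  "std_gaussian_vector M g \<longleftrightarrow> prob_space M \<and>
     prob_space.indep_vars M (\<lambda>_. borel) (\<lambda>i w. g w $ i) UNIV \<and>
     (\<forall>i. distributed M lborel (\<lambda>w. g w $ i) std_normal_density)"

text \<open>The quantities below are expectations over a random vector \<open>g\<close> on \<open>M\<close>, which is standard
  Gaussian where they are used. The supremum is the one of \<^typ>\<open>real\<close>, hence meaningful for
  nonempty bounded \<open>C\<close>; likewise \<^const>\<open>infdist\<close> is the distance for nonempty sets.\<close>

definition gaussian_width :: "'w measure \<Rightarrow> ('w \<Rightarrow> real ^ 'n) \<Rightarrow> (real ^ 'n) set \<Rightarrow> real" where
  "gaussian_width M g C = (\<integral>w. (SUP y\<in>C. y \<bullet> g w) \<partial>M)"

definition stat_dim :: "'w measure \<Rightarrow> ('w \<Rightarrow> real ^ 'n) \<Rightarrow> (real ^ 'n \<Rightarrow> ereal) \<Rightarrow> real ^ 'n \<Rightarrow> real" where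
  "stat_dim M g f x = (\<integral>w. (infdist (g w) (cone_of (subdifferential f x)))\<^sup>2 \<partial>M)"

definition stat_dim_upper :: "'w measure \<Rightarrow> ('w \<Rightarrow> real ^ 'n) \<Rightarrow> (real ^ 'n \<Rightarrow> ereal) \<Rightarrow> real ^ 'n \<Rightarrow> real" where
  "stat_dim_upper M g f x =
     (INF t\<in>{0..}. \<integral>w. (infdist (g w) ((*\<^sub>R) t ` subdifferential f x))\<^sup>2 \<partial>M)"

definition stat_dim_error :: "'w measure \<Rightarrow> ('w \<Rightarrow> real ^ 'n) \<Rightarrow> (real ^ 'n \<Rightarrow> ereal) \<Rightarrow> real ^ 'n \<Rightarrow> real" where
  "stat_dim_error M g f x = stat_dim_upper M g f x - stat_dim M g f x"

definition mean_dist_upper :: "'w measure \<Rightarrow> ('w \<Rightarrow> real ^ 'n) \<Rightarrow> (real ^ 'n \<Rightarrow> ereal) \<Rightarrow> real ^ 'n \<Rightarrow> real" where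
  "mean_dist_upper M g f x =
     (INF t\<in>{0..}. \<integral>w. infdist (g w) ((*\<^sub>R) t ` subdifferential f x) \<partial>M)"

definition beta_const :: "('a::real_inner \<Rightarrow> ereal) \<Rightarrow> 'a \<Rightarrow> 'a \<Rightarrow> real" where
  "beta_const f x z0 = norm (arg_min_on norm (subdifferential f x)) / norm z0"

text \<open>Meaningful only if the denominator under the logarithm is positive.\<close>

definition gamma_const :: "real \<Rightarrow> real \<Rightarrow> real" where
  "gamma_const l \<zeta> =
     sqrt 72 * sqrt (ln (3 / (1 - 4 * exp (- l\<^sup>2 / 2) - 2 * exp (- \<zeta>\<^sup>2 / 2))))"

end

theory Submission
  imports Defs
begin

text \<open>
  Let \<open>S\<close> be the subdifferential, \<open>K\<close> the closed cone it generates and \<open>P\<close> the projection onto \<open>K\<close>.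
  The polar of \<open>K\<close> is the closure of the descent cone, so the Gaussian width equals \<open>E dist(g, K)\<close>.
  The hypothesis puts \<open>S\<close> into the hyperplane \<open>z \<bullet> z0 = |z0|\<^sup>2\<close>, hence the scale \<open>t\<close> at which
  \<open>t S\<close> meets \<open>P g\<close> is \<open>T / |z0|\<close> for the 1-Lipschitz function \<open>T = P g \<bullet> z0 / |z0|\<close>. With the
  deterministic scale \<open>t = (E T + k) / |z0|\<close> one has \<open>dist(g, t S) \<le> dist(g, K) + (E T + k - T) \<beta>\<close>
  on the event \<open>T < E T + k\<close>, because a point of \<open>s S\<close> with \<open>s < t\<close> enters \<open>t S\<close> by adding
  \<open>(t - s) z1\<close>. The three functions \<open>dist(g, t S)\<close>, \<open>dist(g, K)\<close> and \<open>T\<close> have variance at most 2 by a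
  Gaussian Poincare inequality, and Cantelli's inequality turns the bound on the event into
  \<open>E dist(g, t S) - E dist(g, K) \<le> \<beta> (k + 2 / k) + 4 / k\<close>. Taking \<open>k = 5 / 2\<close> gives the second
  claim. Taking \<open>k = \<lambda>\<close> and adding the variance gives the first one; the sub-Gaussian tails behind
  the constant \<open>\<gamma>\<close> are not needed, since \<open>\<gamma> \<ge> 8\<close>, \<open>\<lambda>\<^sup>2 > 5 / 2\<close> and \<open>\<zeta> > 1\<close> whenever
  \<open>\<gamma>\<close> is defined.
\<close>

subsection \<open>Rotation invariance of the Gaussian measure\<close>

lemma nn_integral_lborel_shear:
  fixes f :: "'a::euclidean_space \<times> 'a \<Rightarrow> ennreal"
  assumes [measurable]: "f \<in> borel_measurable borel"
  shows "(\<integral>\<^sup>+z. f (fst z + a *\<^sub>R snd z, snd z) \<partial>lborel) = (\<integral>\<^sup>+z. f z \<partial>lborel)"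
    and "(\<integral>\<^sup>+z. f (fst z, snd z + a *\<^sub>R fst z) \<partial>lborel) = (\<integral>\<^sup>+z. f z \<partial>lborel)"
proof -
  have translate: "(\<integral>\<^sup>+x. h (x + t) \<partial>lborel) = (\<integral>\<^sup>+x. h x \<partial>lborel)"
    if "h \<in> borel_measurable borel" for h :: "'a \<Rightarrow> ennreal" and t
  proof -
    have "(\<integral>\<^sup>+x. h x \<partial>lborel) = (\<integral>\<^sup>+x. h x \<partial>distr lborel borel ((+) t))"
      by (simp only: lborel_distr_plus)
    also have "\<dots> = (\<integral>\<^sup>+x. h (x + t) \<partial>lborel)"
      using that by (subst nn_integral_distr) (simp_all add: add.commute)
    finally show ?thesis ..
  qed
  have [measurable]: "f \<in> borel_measurable (borel \<Otimes>\<^sub>M borel)"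
    using assms by (simp add: borel_prod)
  have m: "f \<in> borel_measurable (lborel \<Otimes>\<^sub>M lborel)"
    "(\<lambda>z. f (fst z + a *\<^sub>R snd z, snd z)) \<in> borel_measurable (lborel \<Otimes>\<^sub>M lborel)"
    "(\<lambda>z. f (fst z, snd z + a *\<^sub>R fst z)) \<in> borel_measurable (lborel \<Otimes>\<^sub>M lborel)"
    by measurable
  have "(\<integral>\<^sup>+z. f (fst z + a *\<^sub>R snd z, snd z) \<partial>(lborel \<Otimes>\<^sub>M lborel))
      = (\<integral>\<^sup>+y. \<integral>\<^sup>+x. f (x + a *\<^sub>R y, y) \<partial>lborel \<partial>lborel)"
    using lborel_pair.nn_integral_snd[OF m(2)] by simp
  also have "\<dots> = (\<integral>\<^sup>+y. \<integral>\<^sup>+x. f (x, y) \<partial>lborel \<partial>lborel)"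
    by (intro nn_integral_cong translate) measurable
  also have "\<dots> = (\<integral>\<^sup>+z. f z \<partial>(lborel \<Otimes>\<^sub>M lborel))"
    using lborel_pair.nn_integral_snd[OF m(1)] by simp
  finally show "(\<integral>\<^sup>+z. f (fst z + a *\<^sub>R snd z, snd z) \<partial>lborel) = (\<integral>\<^sup>+z. f z \<partial>lborel)"
    by (simp only: lborel_prod)
  have "(\<integral>\<^sup>+z. f (fst z, snd z + a *\<^sub>R fst z) \<partial>(lborel \<Otimes>\<^sub>M lborel))
      = (\<integral>\<^sup>+x. \<integral>\<^sup>+y. f (x, y + a *\<^sub>R x) \<partial>lborel \<partial>lborel)"
    using lborel.nn_integral_fst[OF m(3)] by simp
  also have "\<dots> = (\<integral>\<^sup>+x. \<integral>\<^sup>+y. f (x, y) \<partial>lborel \<partial>lborel)"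
    by (intro nn_integral_cong translate) measurable
  also have "\<dots> = (\<integral>\<^sup>+z. f z \<partial>(lborel \<Otimes>\<^sub>M lborel))"
    using lborel.nn_integral_fst[OF m(1)] by simp
  finally show "(\<integral>\<^sup>+z. f (fst z, snd z + a *\<^sub>R fst z) \<partial>lborel) = (\<integral>\<^sup>+z. f z \<partial>lborel)"
    by (simp only: lborel_prod)
qed

text \<open>The orientation is chosen so that \<open>fst (rot \<theta> z)\<close> starts at
  \<open>fst z\<close> with velocity \<open>snd z\<close> and reaches \<open>snd z\<close> at angle
  \<open>pi / 2\<close>.\<close>

definition rot :: "real \<Rightarrow> 'a \<times> 'a \<Rightarrow> 'a \<times> 'a::real_vector" where
  "rot \<theta> z = (cos \<theta> *\<^sub>R fst z + sin \<theta> *\<^sub>R snd z, cos \<theta> *\<^sub>R snd z - sin \<theta> *\<^sub>R fst z)"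

lemma measurable_rot [measurable]:
  "rot \<theta> \<in> borel_measurable (borel :: ('a::euclidean_space \<times> 'a) measure)"
  unfolding rot_def[abs_def] by (intro borel_measurable_continuous_onI continuous_intros)

text \<open>A rotation is a product of three shears, each of which preserves Lebesgue measure by
  Fubini and translation invariance.\<close>

lemma nn_integral_lborel_rot:
  fixes f :: "'a::euclidean_space \<times> 'a \<Rightarrow> ennreal"
  assumes [measurable]: "f \<in> borel_measurable borel" and "cos \<theta> \<noteq> -1"
  shows "(\<integral>\<^sup>+z. f (rot \<theta> z) \<partial>lborel) = (\<integral>\<^sup>+z. f z \<partial>lborel)"
proof -
  \<comment> \<open>\<open>\<tau>\<close> is the tangent of half the angle; it has a pole exactly
    where \<open>cos \<theta> = -1\<close>.\<close>
  define c s \<tau> where "c = cos \<theta>" and "s = sin \<theta>" and "\<tau> = s / (1 + c)"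
  have \<tau>1: "1 - s * \<tau> = c" "1 - \<tau> * s = c"
  proof -
    have "s * s = (1 - c) * (1 + c)"
      using sin_squared_eq[of \<theta>] by (simp add: c_def s_def power2_eq_square algebra_simps)
    moreover have "1 + c \<noteq> 0"
      using assms(2) by (auto simp: c_def add_eq_0_iff)
    ultimately show "1 - s * \<tau> = c" by (simp add: \<tau>_def)
    then show "1 - \<tau> * s = c" by (simp add: mult.commute)
  qed
  have \<tau>2: "\<tau> + \<tau> * c = s"
  proof -
    have "1 + c \<noteq> 0"
      using assms(2) by (auto simp: c_def add_eq_0_iff)
    then have "\<tau> * (1 + c) = s" by (simp add: \<tau>_def)
    then show ?thesis by (simp add: algebra_simps)
  qed
  define A B where "A = (\<lambda>z::'a\<times>'a. (fst z + \<tau> *\<^sub>R snd z, snd z))"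
    and "B = (\<lambda>z::'a\<times>'a. (fst z, snd z + (-s) *\<^sub>R fst z))"
  have [measurable]: "A \<in> borel_measurable borel" "B \<in> borel_measurable borel"
    unfolding A_def B_def by (intro borel_measurable_continuous_onI continuous_intros)+
  have *: "rot \<theta> z = A (B (A z))" for z
  proof -
    obtain x y where z: "z = (x, y)" by fastforce
    have "x + \<tau> *\<^sub>R y + \<tau> *\<^sub>R (y - s *\<^sub>R (x + \<tau> *\<^sub>R y))
        = (1 - \<tau> * s) *\<^sub>R x + (\<tau> + \<tau> * (1 - s * \<tau>)) *\<^sub>R y"
      by (simp add: algebra_simps flip: scaleR_2)
    moreover have "y - s *\<^sub>R (x + \<tau> *\<^sub>R y) = (1 - s * \<tau>) *\<^sub>R y - s *\<^sub>R x"
      by (simp add: algebra_simps)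
    ultimately show ?thesis
      unfolding \<tau>1 \<tau>2 by (simp add: A_def B_def rot_def z c_def s_def)
  qed
  have A: "(\<integral>\<^sup>+z. h (A z) \<partial>lborel) = (\<integral>\<^sup>+z. h z \<partial>lborel)"
    and B: "(\<integral>\<^sup>+z. h (B z) \<partial>lborel) = (\<integral>\<^sup>+z. h z \<partial>lborel)"
    if "h \<in> borel_measurable borel" for h
    unfolding A_def B_def by (rule nn_integral_lborel_shear[OF that])+
  have "(\<integral>\<^sup>+z. f (A (B (A z))) \<partial>lborel) = (\<integral>\<^sup>+z. f (A (B z)) \<partial>lborel)"
    by (rule A) measurable
  also have "\<dots> = (\<integral>\<^sup>+z. f (A z) \<partial>lborel)"
    by (rule B) measurable
  also have "\<dots> = (\<integral>\<^sup>+z. f z \<partial>lborel)"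
    by (rule A) measurable
  finally show ?thesis unfolding * .
qed

section \<open>Moments and density of a standard Gaussian vector\<close>

locale gaussian_vector =
  fixes M :: "'w measure" and g :: "'w \<Rightarrow> real ^ 'n"
  assumes std_gaussian: "std_gaussian_vector M g"

sublocale gaussian_vector \<subseteq> prob_space M
  using std_gaussian by (simp add: std_gaussian_vector_def)

context gaussian_vector
begin

lemma indep: "indep_vars (\<lambda>_. borel) (\<lambda>i w. g w $ i) UNIV"
  and distr: "distributed M lborel (\<lambda>w. g w $ i) std_normal_density"
  using std_gaussian by (auto simp: std_gaussian_vector_def)

lemma measurable_g [measurable]: "g \<in> borel_measurable M"
proof -
  have *: "(\<lambda>w. g w $ i) \<in> borel_measurable M" for i
    using distributed_measurable[OF distr[of i]] by (simp only: measurable_lborel1)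
  show ?thesis
  proof (rule borel_measurable_euclidean_space[THEN iffD2, OF ballI])
    fix b :: "real ^ 'n" assume "b \<in> Basis"
    then obtain i where "b = axis i 1" by (auto simp: Basis_vec_def)
    then show "(\<lambda>w. g w \<bullet> b) \<in> borel_measurable M" by (simp add: inner_axis *)
  qed
qed

lemma expectation_component: "expectation (\<lambda>w. g w $ i) = 0"
  using standard_normal_distributed_expectation[OF distr] .

lemma integrable_component: "integrable M (\<lambda>w. g w $ i)"
  using integrable_std_normal_moment[of 1] distributed_integrable[OF distr[of i], of "\<lambda>x. x"] by simp

lemma integrable_component_square: "integrable M (\<lambda>w. (g w $ i)\<^sup>2)"
  using integrable_std_normal_moment[of 2] distributed_integrable[OF distr[of i], of "\<lambda>x. x\<^sup>2"] by simp

lemma expectation_component_square: "expectation (\<lambda>w. (g w $ i)\<^sup>2) = 1"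
  using standard_normal_distributed_variance[OF distr[of i]] by (simp add: expectation_component)

lemma expectation_component_mult:
  assumes "i \<noteq> j"
  shows "integrable M (\<lambda>w. g w $ i * g w $ j)" "expectation (\<lambda>w. g w $ i * g w $ j) = 0"
proof -
  have *: "indep_vars (\<lambda>_. borel) (\<lambda>i w. g w $ i) {i, j}"
    using indep by (rule indep_vars_subset) auto
  show "integrable M (\<lambda>w. g w $ i * g w $ j)"
    using indep_vars_integrable[OF _ *] integrable_component assms by simp
  show "expectation (\<lambda>w. g w $ i * g w $ j) = 0"
    using indep_vars_lebesgue_integral[OF _ *] integrable_component assms
    by (simp add: expectation_component)
qed

lemma integrable_norm_square: "integrable M (\<lambda>w. (norm (g w))\<^sup>2)"
  by (simp add: norm_vec_def L2_set_def sum_nonneg) (intro Bochner_Integration.integrable_sum integrable_component_square)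

text \<open>The components are uncorrelated with unit second moment, so only the diagonal of the
  double sum survives.\<close>

lemma expectation_inner_square: "expectation (\<lambda>w. (v \<bullet> g w)\<^sup>2) = (norm v)\<^sup>2"
proof -
  have *: "(v \<bullet> g w)\<^sup>2 = (\<Sum>i\<in>UNIV. \<Sum>j\<in>UNIV. v $ i * v $ j * (g w $ i * g w $ j))" for w
    by (simp add: inner_vec_def power2_eq_square sum_product algebra_simps)
  have int: "integrable M (\<lambda>w. g w $ i * g w $ j)" for i j
    using expectation_component_mult(1) integrable_component_square[of i]
    by (cases "i = j") (auto simp: power2_eq_square)
  have val: "expectation (\<lambda>w. g w $ i * g w $ j) = (if i = j then 1 else 0)" for i j
    using expectation_component_mult(2) expectation_component_square[of i]
    by (auto simp: power2_eq_square)
  have "expectation (\<lambda>w. (v \<bullet> g w)\<^sup>2) = (\<Sum>i\<in>UNIV. \<Sum>j\<in>UNIV. v $ i * v $ j * (if i = j then 1 else 0))"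
    unfolding * by (subst Bochner_Integration.integral_sum
        | intro Bochner_Integration.integrable_sum integrable_mult_right int sum.cong refl | simp add: val)+
  also have "\<dots> = (norm v)\<^sup>2"
    by (simp add: norm_vec_def L2_set_def sum_nonneg power2_eq_square if_distrib[of "\<lambda>x. _ * x"] sum.If_cases cong: if_cong)
  finally show "expectation (\<lambda>w. (v \<bullet> g w)\<^sup>2) = (norm v)\<^sup>2" .
qed

abbreviation law :: "(real ^ 'n) measure" where
  "law \<equiv> distr M borel g"

definition gdensity :: "real ^ 'n \<Rightarrow> ennreal" where
  "gdensity x = (\<Prod>i\<in>UNIV. ennreal (std_normal_density (x $ i)))"

lemma measurable_gdensity [measurable]: "gdensity \<in> borel_measurable borel"
  unfolding gdensity_def by measurable

text \<open>Dividing the law by the Gaussian density gives the volume of every box, so it is Lebesgue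
  measure.\<close>

lemma density_law: "density law (\<lambda>x. 1 / gdensity x) = lborel"
proof (rule lborel_eqI[symmetric])
  fix l u :: "real ^ 'n" assume le: "\<And>b. b \<in> Basis \<Longrightarrow> l \<bullet> b \<le> u \<bullet> b"
  \<comment> \<open>The integrand over the box factors into the \<open>h i\<close>; independence
    reduces the claim to one dimension, where the density cancels the denominator.\<close>
  define h where "h i y = 1 / ennreal (std_normal_density y) * indicator {l $ i <..< u $ i} y" for i y
  have [measurable]: "h i \<in> borel_measurable borel" for i
    unfolding h_def by measurable
  have pos: "std_normal_density y > 0" for y
    by (rule normal_density_pos) simp
  have box: "indicator (box l u) x = (\<Prod>i\<in>UNIV. indicator {l $ i <..< u $ i} (x $ i) :: ennreal)" for x
    by (auto simp: indicator_def mem_box_cart split: if_splits)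
  have inv: "1 / gdensity x = (\<Prod>i\<in>UNIV. 1 / ennreal (std_normal_density (x $ i)))" for x
    unfolding gdensity_def using pos
    by (simp add: prod_ennreal divide_ennreal prod_dividef prod_pos less_imp_neq[symmetric] flip: ennreal_1)
  have "emeasure (density law (\<lambda>x. 1 / gdensity x)) (box l u)
      = (\<integral>\<^sup>+w. 1 / gdensity (g w) * indicator (box l u) (g w) \<partial>M)"
    by (simp add: emeasure_density nn_integral_distr)
  also have "\<dots> = (\<integral>\<^sup>+w. (\<Prod>i\<in>UNIV. h i (g w $ i)) \<partial>M)"
    unfolding inv box h_def prod.distrib ..
  also have "\<dots> = (\<Prod>i\<in>UNIV. \<integral>\<^sup>+w. h i (g w $ i) \<partial>M)"
    by (rule indep_vars_nn_integral) (auto intro: indep_vars_compose2[OF indep])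
  also have "\<dots> = (\<Prod>i\<in>UNIV. ennreal (u $ i - l $ i))"
  proof (rule prod.cong)
    fix i :: 'n
    have "(\<integral>\<^sup>+w. h i (g w $ i) \<partial>M) = (\<integral>\<^sup>+y. ennreal (std_normal_density y) * h i y \<partial>lborel)"
      by (rule distributed_nn_integral[OF distr, symmetric]) simp
    also have "\<dots> = (\<integral>\<^sup>+y. indicator {l $ i <..< u $ i} y \<partial>lborel)"
    proof (rule nn_integral_cong)
      fix y
      have "ennreal (std_normal_density y) * (1 / ennreal (std_normal_density y)) = 1"
        using pos[of y] by (simp add: divide_ennreal ennreal_mult[symmetric] flip: ennreal_1)
      then show "ennreal (std_normal_density y) * h i y = indicator {l $ i <..< u $ i} y"
        by (simp add: h_def mult.assoc[symmetric])
    qed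
    also have "\<dots> = ennreal (u $ i - l $ i)"
      using le[of "axis i 1"] by (simp add: inner_axis)
    finally show "(\<integral>\<^sup>+w. h i (g w $ i) \<partial>M) = ennreal (u $ i - l $ i)" .
  qed simp
  also have "\<dots> = ennreal (\<Prod>i\<in>UNIV. (u - l) $ i)"
    using le[OF axis_in_Basis_iff[THEN iffD2]] by (subst prod_ennreal) (auto simp: inner_axis)
  also have "(\<Prod>i\<in>UNIV. (u - l) $ i) = (\<Prod>b\<in>Basis. (u - l) \<bullet> b)"
  proof -
    have *: "(Basis :: (real ^ 'n) set) = range (\<lambda>i. axis i 1)"
      by (auto simp: Basis_vec_def)
    have "inj (\<lambda>i::'n. axis i (1::real))"
      by (auto simp: inj_def axis_eq_axis)
    then show ?thesis unfolding * by (simp add: prod.reindex inner_axis)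
  qed
  finally show "emeasure (density law (\<lambda>x. 1 / gdensity x)) (box l u) = ennreal (\<Prod>b\<in>Basis. (u - l) \<bullet> b)" .
qed simp

text \<open>The density is positive and finite at every point, so multiplying by it undoes the
  division in \<open>density_law\<close>.\<close>

lemma law_eq_density: "law = density lborel gdensity"
proof -
  have "1 / gdensity x * gdensity x = 1" for x
  proof -
    have "(\<Prod>i\<in>UNIV. std_normal_density (x $ i)) > 0"
      by (intro prod_pos) (auto intro!: normal_density_pos)
    then show ?thesis
      unfolding gdensity_def
      by (subst (1 2) prod_ennreal)
        (simp_all add: divide_ennreal ennreal_mult[symmetric] del: prod_zero_iff flip: ennreal_1)
  qed
  then have "density (density law (\<lambda>x. 1 / gdensity x)) gdensity = law"
    by (subst density_density_eq) (simp_all add: density_1)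
  then show ?thesis unfolding density_law by simp
qed

end

sublocale gaussian_vector \<subseteq> law: prob_space law
  by (rule prob_space_distr) simp

sublocale gaussian_vector \<subseteq> pair: pair_prob_space law law ..

context gaussian_vector
begin

text \<open>The joint density depends on each coordinate pair only through the sum of its squares,
  which a rotation preserves.\<close>

lemma gdensity_rot: "gdensity (fst (rot \<theta> z)) * gdensity (snd (rot \<theta> z)) = gdensity (fst z) * gdensity (snd z)"
proof -
  have *: "std_normal_density (cos \<theta> * a + sin \<theta> * b) * std_normal_density (cos \<theta> * b - sin \<theta> * a)
    = std_normal_density a * std_normal_density b" for a b
  proof -
    have "(cos \<theta> * a + sin \<theta> * b)\<^sup>2 + (cos \<theta> * b - sin \<theta> * a)\<^sup>2 = ((sin \<theta>)\<^sup>2 + (cos \<theta>)\<^sup>2) * (a\<^sup>2 + b\<^sup>2)"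
      by (simp add: power2_eq_square algebra_simps del: sin_cos_squared_add sin_cos_squared_add2 sin_cos_squared_add3)
    then show ?thesis
      by (simp add: std_normal_density_def exp_add[symmetric] add_divide_distrib[symmetric])
  qed
  show ?thesis
    by (simp add: gdensity_def prod.distrib[symmetric] ennreal_mult[symmetric] rot_def *)
qed

lemma distr_rot:
  assumes "cos \<theta> \<noteq> -1"
  shows "distr (law \<Otimes>\<^sub>M law) borel (rot \<theta>) = law \<Otimes>\<^sub>M law"
proof -
  define D where "D = (\<lambda>z. gdensity (fst z) * gdensity (snd z))"
  have [measurable]: "D \<in> borel_measurable borel"
    unfolding D_def borel_prod[symmetric] by measurable
  have "sigma_finite_measure (density lborel gdensity)"
    unfolding law_eq_density[symmetric] ..
  then have *: "law \<Otimes>\<^sub>M law = density lborel D"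
    unfolding law_eq_density
    by (subst pair_measure_density) (simp_all add: D_def lborel_prod case_prod_beta' lborel.sigma_finite_measure_axioms)
  show ?thesis
    unfolding *
  proof (rule measure_eqI)
    fix X assume "X \<in> sets (distr (density lborel D) borel (rot \<theta>))"
    then have [measurable]: "X \<in> sets borel" by simp
    have "emeasure (distr (density lborel D) borel (rot \<theta>)) X
        = (\<integral>\<^sup>+z. indicator X z \<partial>distr (density lborel D) borel (rot \<theta>))"
      by simp
    also have "\<dots> = (\<integral>\<^sup>+z. D z * indicator X (rot \<theta> z) \<partial>lborel)"
      by (subst nn_integral_distr, simp, simp, subst nn_integral_density) simp_all
    also have "\<dots> = (\<integral>\<^sup>+z. D (rot \<theta> z) * indicator X (rot \<theta> z) \<partial>lborel)"
      by (simp add: D_def gdensity_rot)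
    also have "\<dots> = (\<integral>\<^sup>+z. D z * indicator X z \<partial>lborel)"
      by (rule nn_integral_lborel_rot[of "\<lambda>z. D z * indicator X z"]) (use assms in auto)
    also have "\<dots> = emeasure (density lborel D) X"
      by (simp add: emeasure_density)
    finally show "emeasure (distr (density lborel D) borel (rot \<theta>)) X = emeasure (density lborel D) X" .
  qed simp
qed

end

subsection \<open>A Gaussian Poincare inequality\<close>

lemma rot_0: "rot 0 z = z"
  and rot_pi_half: "fst (rot (pi / 2) z) = snd z"
  and rot_add: "rot (s + t) z = rot t (rot s z)"
  by (simp_all add: rot_def cos_add sin_add algebra_simps prod_eq_iff)

text \<open>The half-angle formula bounds \<open>1 - cos \<theta>\<close> by
  \<open>\<theta>\<close>. After rescaling, this linear bound is the dominating function in
  \<open>pair_poincare\<close>.\<close>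

lemma norm_fst_rot_diff_le:
  assumes "0 \<le> \<theta>"
  shows "norm (fst z - fst (rot \<theta> z)) \<le> \<theta> * (norm (fst z) + norm (snd z :: 'a::real_normed_vector))"
proof -
  have "1 - cos \<theta> = 2 * (sin (\<theta> / 2))\<^sup>2"
    using cos_double_sin[of "\<theta> / 2"] by simp
  also have "\<dots> \<le> 2 * (\<bar>sin (\<theta> / 2)\<bar> * 1)"
    using mult_left_mono[OF abs_sin_le_one[of "\<theta> / 2"], of "\<bar>sin (\<theta> / 2)\<bar>"]
    by (simp add: power2_eq_square)
  also have "\<dots> \<le> \<theta>"
    using abs_sin_x_le_abs_x[of "\<theta> / 2"] assms by simp
  finally have c: "\<bar>1 - cos \<theta>\<bar> \<le> \<theta>" using cos_le_one[of \<theta>] by simp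
  have "fst z - fst (rot \<theta> z) = (1 - cos \<theta>) *\<^sub>R fst z - sin \<theta> *\<^sub>R snd z"
    by (simp add: rot_def algebra_simps)
  then have "norm (fst z - fst (rot \<theta> z)) \<le> \<bar>1 - cos \<theta>\<bar> * norm (fst z) + \<bar>sin \<theta>\<bar> * norm (snd z)"
    by (metis norm_scaleR norm_triangle_ineq4)
  also have "\<dots> \<le> \<theta> * norm (fst z) + \<theta> * norm (snd z)"
    using c abs_sin_x_le_abs_x[of \<theta>] assms by (intro add_mono mult_right_mono) auto
  finally show ?thesis by (simp add: algebra_simps)
qed

lemma lipschitz_of_gradient_bound:
  fixes h :: "'a::euclidean_space \<Rightarrow> real"
  assumes der: "\<And>x. (h has_derivative (\<lambda>v. a x \<bullet> v)) (at x)"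
    and a: "\<And>x. norm (a x) \<le> 1"
  shows "\<bar>h x - h y\<bar> \<le> norm (x - y)"
proof -
  have "onorm (\<lambda>v. a z \<bullet> v) \<le> 1" for z
  proof (rule onorm_le)
    show "norm (a z \<bullet> v) \<le> 1 * norm v" for v
      using Cauchy_Schwarz_ineq2[of "a z" v] mult_right_mono[OF a[of z] norm_ge_zero[of v]] by simp
  qed
  then have "norm (h x - h y) \<le> 1 * norm (x - y)"
    using der by (intro differentiable_bound[of UNIV h]) auto
  then show ?thesis by simp
qed

context gaussian_vector
begin

lemma sets_pair_law: "sets (law \<Otimes>\<^sub>M law) = sets (borel :: ((real ^ 'n) \<times> (real ^ 'n)) measure)"
  using sets_pair_measure_cong[OF sets_distr sets_distr, of M borel g M borel g] by (simp only: borel_prod)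

lemma measurable_pair_law: "\<phi> \<in> borel_measurable borel \<Longrightarrow> \<phi> \<in> borel_measurable (law \<Otimes>\<^sub>M law)"
  by (simp only: measurable_cong_sets[OF sets_pair_law refl])

lemma integral_rot:
  fixes \<phi> :: "(real ^ 'n) \<times> (real ^ 'n) \<Rightarrow> real"
  assumes "\<phi> \<in> borel_measurable borel" and "cos \<theta> \<noteq> -1"
  shows "(\<integral>z. \<phi> (rot \<theta> z) \<partial>(law \<Otimes>\<^sub>M law)) = (\<integral>z. \<phi> z \<partial>(law \<Otimes>\<^sub>M law))"
proof -
  have "(\<integral>z. \<phi> z \<partial>distr (law \<Otimes>\<^sub>M law) borel (rot \<theta>)) = (\<integral>z. \<phi> (rot \<theta> z) \<partial>(law \<Otimes>\<^sub>M law))"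
    by (rule integral_distr[OF measurable_pair_law assms(1)]) (rule measurable_rot)
  then show ?thesis by (simp add: distr_rot[OF assms(2)])
qed

lemma integrable_law_norm_square: "integrable law (\<lambda>x. (norm x)\<^sup>2)"
  using integrable_norm_square by (subst integrable_distr_eq) simp_all

lemma integrable_pair_norms:
  "integrable (law \<Otimes>\<^sub>M law) (\<lambda>z. (norm (fst z))\<^sup>2 + (norm (snd z))\<^sup>2)"
proof (intro Bochner_Integration.integrable_add; rule pair.Fubini_integrable)
  show "(\<lambda>z. (norm (fst z))\<^sup>2) \<in> borel_measurable (law \<Otimes>\<^sub>M law)"
    "(\<lambda>z. (norm (snd z))\<^sup>2) \<in> borel_measurable (law \<Otimes>\<^sub>M law)"
    by (intro measurable_pair_law borel_measurable_continuous_onI continuous_intros)+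
qed (use integrable_law_norm_square in \<open>simp_all add: law.prob_space[simplified]\<close>)

lemma integrable_pair_bound:
  fixes \<phi> :: "(real ^ 'n) \<times> (real ^ 'n) \<Rightarrow> real"
  assumes "\<phi> \<in> borel_measurable borel"
    and "\<And>z. \<bar>\<phi> z\<bar> \<le> c * (norm (fst z) + norm (snd z))"
  shows "integrable (law \<Otimes>\<^sub>M law) (\<lambda>z. (\<phi> z)\<^sup>2)"
proof (rule Bochner_Integration.integrable_bound)
  show "integrable (law \<Otimes>\<^sub>M law) (\<lambda>z. 2 * c\<^sup>2 * ((norm (fst z))\<^sup>2 + (norm (snd z))\<^sup>2))"
    by (intro integrable_mult_right integrable_pair_norms)
  show "(\<lambda>z. (\<phi> z)\<^sup>2) \<in> borel_measurable (law \<Otimes>\<^sub>M law)"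
    using assms(1) by (intro measurable_pair_law) measurable
  have "norm ((\<phi> z)\<^sup>2) \<le> norm (2 * c\<^sup>2 * ((norm (fst z))\<^sup>2 + (norm (snd z))\<^sup>2))" for z
  proof -
    have "\<bar>\<phi> z\<bar>\<^sup>2 \<le> (c * (norm (fst z) + norm (snd z)))\<^sup>2"
      by (intro power_mono assms(2)) simp
    also have "\<dots> \<le> c\<^sup>2 * (2 * ((norm (fst z))\<^sup>2 + (norm (snd z))\<^sup>2))"
      using sum_squares_bound[of "norm (fst z)" "norm (snd z)"]
      by (simp only: power_mult_distrib, intro mult_left_mono) (simp_all add: power2_sum)
    finally show ?thesis by (simp add: algebra_simps)
  qed
  then show "AE z in law \<Otimes>\<^sub>M law. norm ((\<phi> z)\<^sup>2) \<le> norm (2 * c\<^sup>2 * ((norm (fst z))\<^sup>2 + (norm (snd z))\<^sup>2))"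
    by simp
qed

text \<open>The Maurey-Pisier argument: interpolate between two independent Gaussian vectors along a
  quarter circle. Every increment of the subdivided path has the same law, and after rescaling the
  first increment tends to a derivative of \<open>h\<close> in an independent Gaussian direction.\<close>

lemma pair_poincare:
  fixes h :: "real ^ 'n \<Rightarrow> real"
  assumes der: "\<And>x. (h has_derivative (\<lambda>v. a x \<bullet> v)) (at x)"
    and a: "\<And>x. norm (a x) \<le> 1"
  shows "(\<integral>z. (h (fst z) - h (snd z))\<^sup>2 \<partial>(law \<Otimes>\<^sub>M law)) \<le> (pi / 2)\<^sup>2"
proof -
  let ?P = "law \<Otimes>\<^sub>M law"
  note lip = lipschitz_of_gradient_bound[OF der a]
  have h_cont: "continuous_on S h" for S
    using der by (auto intro!: continuous_at_imp_continuous_on has_derivative_continuous)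
  \<comment> \<open>\<open>D \<theta> z\<close> is the start value minus the end value of
    \<open>h\<close> over the first arc; at \<open>rot s z\<close> it is the same for the arc from
    \<open>s\<close> to \<open>s + \<theta>\<close>.\<close>
  define D where "D \<theta> z = h (fst z) - h (fst (rot \<theta> z))" for \<theta> z
  have [measurable]: "D \<theta> \<in> borel_measurable borel" for \<theta>
    unfolding D_def rot_def
    by (intro borel_measurable_continuous_onI continuous_intros continuous_on_compose2[OF h_cont _ subset_UNIV])
  have diff_meas: "(\<lambda>z. h (fst z) - h (snd z)) \<in> borel_measurable borel"
    by (intro borel_measurable_continuous_onI continuous_intros continuous_on_compose2[OF h_cont _ subset_UNIV])
  have diff_le: "\<bar>h (fst z) - h (snd z)\<bar> \<le> 1 * (norm (fst z) + norm (snd z))" for z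
    using order_trans[OF lip norm_triangle_ineq4] by simp
  define \<theta> where "\<theta> n = pi / 2 / real (Suc n)" for n
  have \<theta>_pos: "0 < \<theta> n" for n by (simp add: \<theta>_def)
  have \<theta>_mult: "real (Suc n) * \<theta> n = pi / 2" for n by (simp add: \<theta>_def del: of_nat_Suc)
  have D_bound: "\<bar>D (\<theta> n) z\<bar> \<le> \<theta> n * (norm (fst z) + norm (snd z))" for n z
    unfolding D_def using order_trans[OF lip norm_fst_rot_diff_le] \<theta>_pos[of n] by (simp add: less_imp_le)
  have int_D: "integrable ?P (\<lambda>z. (D (\<theta> n) z)\<^sup>2)" for n
    by (rule integrable_pair_bound[OF _ D_bound]) measurable
  have int_rot: "integrable ?P (\<lambda>z. (D (\<theta> n) (rot s z))\<^sup>2)" if "cos s \<noteq> -1" for n s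
  proof -
    have "integrable (distr ?P borel (rot s)) (\<lambda>z. (D (\<theta> n) z)\<^sup>2)"
      using int_D by (simp add: distr_rot[OF that])
    then show ?thesis
      by (rule integrable_distr[OF measurable_pair_law[OF measurable_rot]])
  qed
  \<comment> \<open>Cauchy-Schwarz for the telescoping sum over the \<open>Suc n\<close> arcs costs
    one factor \<open>Suc n\<close>; rotation invariance makes the summands equal in mean, which
    gives the other.\<close>
  have le: "(\<integral>z. (h (fst z) - h (snd z))\<^sup>2 \<partial>?P) \<le> (\<integral>z. (real (Suc n) * D (\<theta> n) z)\<^sup>2 \<partial>?P)" for n
  proof -
    have cos: "cos (real k * \<theta> n) \<noteq> -1" if "k < Suc n" for k
    proof -
      have "real k * \<theta> n \<le> real (Suc n) * \<theta> n"
        using that \<theta>_pos[of n] by (intro mult_right_mono) auto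
      then have "real k * \<theta> n \<le> pi / 2" by (simp only: \<theta>_mult)
      then have "cos (real k * \<theta> n) \<ge> 0"
        using \<theta>_pos[of n] by (intro cos_ge_zero order_trans[OF _ mult_nonneg_nonneg]) (auto simp: less_imp_le)
      then show ?thesis by simp
    qed
    have "(h (fst z) - h (snd z))\<^sup>2 \<le> real (Suc n) * (\<Sum>k<Suc n. (D (\<theta> n) (rot (real k * \<theta> n) z))\<^sup>2)" for z
    proof -
      define q where "q k = h (fst (rot (real k * \<theta> n) z))" for k
      have "(\<Sum>k<Suc n. D (\<theta> n) (rot (real k * \<theta> n) z)) = (\<Sum>k<Suc n. q k - q (Suc k))"
      proof (rule sum.cong)
        fix k
        have "real (Suc k) * \<theta> n = real k * \<theta> n + \<theta> n" by (simp add: algebra_simps)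
        then show "D (\<theta> n) (rot (real k * \<theta> n) z) = q k - q (Suc k)"
          by (simp only: D_def q_def rot_add)
      qed simp
      also have "\<dots> = q 0 - q (Suc n)" by (rule sum_lessThan_telescope')
      also have "\<dots> = h (fst z) - h (snd z)"
        unfolding q_def \<theta>_mult by (simp add: rot_0 rot_pi_half)
      finally show ?thesis
        using sum_squared_le_sum_of_squares[of "\<lambda>k. D (\<theta> n) (rot (real k * \<theta> n) z)" "{..<Suc n}"]
        by (simp add: mult.commute)
    qed
    then have "(\<integral>z. (h (fst z) - h (snd z))\<^sup>2 \<partial>?P)
        \<le> (\<integral>z. real (Suc n) * (\<Sum>k<Suc n. (D (\<theta> n) (rot (real k * \<theta> n) z))\<^sup>2) \<partial>?P)"
      by (intro integral_mono integrable_mult_right Bochner_Integration.integrable_sum int_rot cos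
          integrable_pair_bound[OF diff_meas diff_le]) auto
    also have "\<dots> = real (Suc n) * (\<Sum>k<Suc n. \<integral>z. (D (\<theta> n) (rot (real k * \<theta> n) z))\<^sup>2 \<partial>?P)"
      by (simp only: integral_mult_right_zero, subst Bochner_Integration.integral_sum)
        (use int_rot cos in auto)
    also have "\<dots> = real (Suc n) * (\<Sum>k<Suc n. \<integral>z. (D (\<theta> n) z)\<^sup>2 \<partial>?P)"
      by (intro arg_cong2[of _ _ _ _ times] sum.cong refl integral_rot[of "\<lambda>z. (D _ z)\<^sup>2"])
        (use cos in \<open>auto, measurable\<close>)
    also have "\<dots> = (\<integral>z. (real (Suc n) * D (\<theta> n) z)\<^sup>2 \<partial>?P)"
      by (simp add: power_mult_distrib power2_eq_square[of "1 + real n"])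
    finally show ?thesis .
  qed
  \<comment> \<open>Since \<open>real (Suc n) = (pi / 2) / \<theta> n\<close>, the rescaled
    increments are \<open>pi / 2\<close> times difference quotients of \<open>h\<close>; the sign is
    negative because \<open>D\<close> subtracts the end value.\<close>
  define L where "L z = - (pi / 2) * (a (fst z) \<bullet> snd z)" for z
  have lim: "(\<lambda>n. real (Suc n) * D (\<theta> n) z) \<longlonglongrightarrow> L z" for z
  proof -
    have "((\<lambda>t. fst (rot t z)) has_derivative (\<lambda>t. t *\<^sub>R snd z)) (at 0)"
      unfolding rot_def by (auto intro!: derivative_eq_intros)
    moreover have "(h has_derivative (\<lambda>v. a (fst z) \<bullet> v)) (at (fst (rot 0 z)))"
      using der by (simp add: rot_0)
    ultimately have "((\<lambda>t. h (fst (rot t z))) has_derivative (\<lambda>t. a (fst z) \<bullet> (t *\<^sub>R snd z))) (at 0)"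
      by (rule has_derivative_compose)
    then have "((\<lambda>t. h (fst (rot t z))) has_real_derivative a (fst z) \<bullet> snd z) (at 0)"
      by (simp add: has_field_derivative_def mult_commute_abs)
    then have "((\<lambda>t. (h (fst (rot t z)) - h (fst z)) / t) \<longlongrightarrow> a (fst z) \<bullet> snd z) (at 0)"
      by (simp add: has_field_derivative_iff rot_0)
    moreover have "filterlim \<theta> (at 0) sequentially"
    proof -
      have "\<theta> \<longlonglongrightarrow> 0"
        unfolding \<theta>_def using LIMSEQ_Suc[OF lim_const_over_n[of "pi / 2"]] by simp
      then show ?thesis
        using \<theta>_pos by (auto simp: filterlim_at less_imp_neq[symmetric])
    qed
    ultimately have "(\<lambda>n. (h (fst (rot (\<theta> n) z)) - h (fst z)) / \<theta> n) \<longlonglongrightarrow> a (fst z) \<bullet> snd z"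
      by (rule filterlim_compose)
    then have "(\<lambda>n. - (pi / 2) * ((h (fst (rot (\<theta> n) z)) - h (fst z)) / \<theta> n)) \<longlonglongrightarrow> L z"
      unfolding L_def by (intro tendsto_intros)
    moreover have "- (pi / 2) * ((h (fst (rot (\<theta> n) z)) - h (fst z)) / \<theta> n) = real (Suc n) * D (\<theta> n) z" for n
      using \<theta>_pos[of n] by (simp add: \<theta>_mult[of n, symmetric] D_def) (simp add: algebra_simps)
    ultimately show ?thesis by simp
  qed
  \<comment> \<open>The gradient map \<open>a\<close> carries no measurability assumption, so
    \<open>L\<close> inherits measurability as a pointwise limit.\<close>
  have L_meas: "L \<in> borel_measurable borel"
    by (rule borel_measurable_LIMSEQ_metric[OF _ lim]) measurable
  have L_le: "\<bar>L z\<bar> \<le> pi / 2 * (norm (fst z) + norm (snd z))" for z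
  proof -
    have "\<bar>a (fst z) \<bullet> snd z\<bar> \<le> norm (a (fst z)) * norm (snd z)"
      by (rule Cauchy_Schwarz_ineq2)
    also have "\<dots> \<le> 1 * norm (snd z)"
      by (intro mult_right_mono a) simp
    finally show ?thesis by (simp add: L_def abs_mult add_increasing)
  qed
  have int_L: "integrable ?P (\<lambda>z. (L z)\<^sup>2)"
    by (rule integrable_pair_bound[OF L_meas L_le])
  have "(\<lambda>n. \<integral>z. (real (Suc n) * D (\<theta> n) z)\<^sup>2 \<partial>?P) \<longlonglongrightarrow> (\<integral>z. (L z)\<^sup>2 \<partial>?P)"
  proof (rule integral_dominated_convergence)
    show "integrable ?P (\<lambda>z. (pi / 2 * (norm (fst z) + norm (snd z)))\<^sup>2)"
      by (rule integrable_pair_bound[where c = "pi / 2"])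
        (intro borel_measurable_continuous_onI continuous_intros, simp)
    have "(real (Suc n) * D (\<theta> n) z)\<^sup>2 \<le> (pi / 2 * (norm (fst z) + norm (snd z)))\<^sup>2" for n z
    proof -
      have "\<bar>real (Suc n) * D (\<theta> n) z\<bar> \<le> real (Suc n) * (\<theta> n * (norm (fst z) + norm (snd z)))"
        unfolding abs_mult using D_bound[of n z] by (intro mult_mono) auto
      also have "\<dots> = pi / 2 * (norm (fst z) + norm (snd z))"
        by (simp only: mult.assoc[symmetric] \<theta>_mult)
      finally show ?thesis by (rule abs_le_square_iff[THEN iffD1, OF order_trans]) simp
    qed
    then show "AE z in ?P. norm ((real (Suc n) * D (\<theta> n) z)\<^sup>2) \<le> (pi / 2 * (norm (fst z) + norm (snd z)))\<^sup>2" for n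
      by simp
    show "AE z in ?P. (\<lambda>n. (real (Suc n) * D (\<theta> n) z)\<^sup>2) \<longlonglongrightarrow> (L z)\<^sup>2"
      using lim by (intro AE_I2 tendsto_intros)
  qed (use int_L in \<open>auto intro!: measurable_pair_law\<close>)
  then have "(\<integral>z. (h (fst z) - h (snd z))\<^sup>2 \<partial>?P) \<le> (\<integral>z. (L z)\<^sup>2 \<partial>?P)"
    using le by (intro LIMSEQ_le_const) auto
  \<comment> \<open>Given the first vector, \<open>L\<close> is linear in the second, independent
    one, so the inner integral is a Gaussian second moment.\<close>
  also have "\<dots> = (\<integral>x. (\<integral>y. (L (x, y))\<^sup>2 \<partial>law) \<partial>law)"
    by (rule pair.integral_fst'[OF int_L, symmetric])
  also have "\<dots> = (\<integral>x. (pi / 2)\<^sup>2 * (norm (a x))\<^sup>2 \<partial>law)"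
  proof (rule Bochner_Integration.integral_cong)
    fix x
    have "(\<integral>y. (L (x, y))\<^sup>2 \<partial>law) = (\<integral>y. (pi / 2)\<^sup>2 * (a x \<bullet> y)\<^sup>2 \<partial>law)"
      by (simp add: L_def power_mult_distrib power_divide)
    also have "\<dots> = (pi / 2)\<^sup>2 * (norm (a x))\<^sup>2"
      using expectation_inner_square[of "a x"] by (subst integral_mult_right_zero, subst integral_distr) simp_all
    finally show "(\<integral>y. (L (x, y))\<^sup>2 \<partial>law) = (pi / 2)\<^sup>2 * (norm (a x))\<^sup>2" .
  qed simp
  also have "\<dots> \<le> (\<integral>x. (pi / 2)\<^sup>2 \<partial>law)"
    using a by (intro Bochner_Integration.integral_mono') (auto simp: power_le_one mult_left_le)
  finally show ?thesis by (simp add: law.prob_space[simplified])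
qed

end

subsection \<open>Distances and projections for closed convex sets\<close>

lemma infdist_lipschitz: "\<bar>infdist x C - infdist y C\<bar> \<le> norm (x - y)"
  for x y :: "'a::real_normed_vector"
  using infdist_triangle_abs[of x C y] by (simp add: dist_norm)

text \<open>A second-order remainder is negligible against \<open>norm (y - x)\<close>. The squared
  distance and \<open>moreau\<close> get their gradients from this criterion.\<close>

lemma has_derivative_inner_quadratic:
  fixes f :: "'a::real_inner \<Rightarrow> real"
  assumes "\<And>y. \<bar>f y - f x - a \<bullet> (y - x)\<bar> \<le> c * (norm (y - x))\<^sup>2"
  shows "(f has_derivative (\<lambda>v. a \<bullet> v)) (at x)"
proof (rule has_derivativeI_sandwich[of 1])
  show "bounded_linear ((\<bullet>) a)" by (rule bounded_linear_inner_right)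
  show "((\<lambda>y. c * norm (y - x)) \<longlongrightarrow> 0) (at x)"
    by (rule tendsto_eq_intros | simp)+
  show "norm (f y - f x - a \<bullet> (y - x)) / norm (y - x) \<le> c * norm (y - x)" if "y \<noteq> x" for y
    using assms[of y] that by (simp add: divide_le_eq power2_eq_square mult.assoc)
qed simp

locale closed_convex =
  fixes C :: "'a::euclidean_space set"
  assumes closed: "closed C" and convex: "convex C" and nonempty: "C \<noteq> {}"
begin

abbreviation P :: "'a \<Rightarrow> 'a" where "P \<equiv> closest_point C"

lemma P_in: "P x \<in> C"
  using closed nonempty by (rule closest_point_in_set)

lemma infdist_eq: "infdist x C = norm (x - P x)"
  using setdist_closest_point[OF closed nonempty, of x] by (simp add: infdist_eq_setdist dist_norm)

lemma P_lipschitz: "norm (P x - P y) \<le> norm (x - y)"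
  using closest_point_lipschitz[OF convex closed nonempty] by (simp add: dist_norm)

text \<open>For the first bound, \<open>P x\<close> competes for the distance of \<open>y\<close>.
  Exchanging the points gives the second with the gradient at \<open>y\<close>; monotonicity of the
  residual \<open>y - P y\<close>, which follows from nonexpansiveness of \<open>P\<close>, trades
  it for the gradient at \<open>x\<close>.\<close>

lemma infdist_square_bounds:
  shows "(infdist y C)\<^sup>2 - (infdist x C)\<^sup>2 - 2 * ((x - P x) \<bullet> (y - x)) \<le> (norm (y - x))\<^sup>2"
    and "- (norm (y - x))\<^sup>2 \<le> (infdist y C)\<^sup>2 - (infdist x C)\<^sup>2 - 2 * ((x - P x) \<bullet> (y - x))"
proof -
  have sq: "(infdist x C)\<^sup>2 = (x - P x) \<bullet> (x - P x)" for x
    by (simp add: infdist_eq power2_norm_eq_inner)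
  have le: "(infdist y C)\<^sup>2 \<le> (y - P x) \<bullet> (y - P x)" for x y
  proof -
    have "infdist y C \<le> norm (y - P x)"
      using infdist_le[OF P_in] by (simp add: dist_norm)
    then have "(infdist y C)\<^sup>2 \<le> (norm (y - P x))\<^sup>2"
      by (rule power_mono) (rule infdist_nonneg)
    then show ?thesis by (simp add: power2_norm_eq_inner)
  qed
  have upper: "(infdist y C)\<^sup>2 - (infdist x C)\<^sup>2 - 2 * ((x - P x) \<bullet> (y - x)) \<le> (norm (y - x))\<^sup>2" for x y
    using le[of y x] unfolding sq[of x]
    by (simp add: power2_norm_eq_inner inner_diff_left inner_diff_right inner_commute)
  then show "(infdist y C)\<^sup>2 - (infdist x C)\<^sup>2 - 2 * ((x - P x) \<bullet> (y - x)) \<le> (norm (y - x))\<^sup>2" .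
  have "(P y - P x) \<bullet> (y - x) \<le> norm (P y - P x) * norm (y - x)"
    by (rule norm_cauchy_schwarz)
  also have "\<dots> \<le> norm (y - x) * norm (y - x)"
    by (intro mult_right_mono P_lipschitz) simp
  finally have "0 \<le> norm (y - x) * norm (y - x) - (P y - P x) \<bullet> (y - x)"
    by simp
  also have "norm (y - x) * norm (y - x) - (P y - P x) \<bullet> (y - x) = ((y - P y) - (x - P x)) \<bullet> (y - x)"
    unfolding power2_eq_square[symmetric] power2_norm_eq_inner
    by (simp add: inner_diff_left inner_diff_right)
  finally have mono: "0 \<le> ((y - P y) - (x - P x)) \<bullet> (y - x)" .
  have "(infdist x C)\<^sup>2 - (infdist y C)\<^sup>2 - 2 * ((y - P y) \<bullet> (x - y)) \<le> (norm (y - x))\<^sup>2"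
    using upper[of x y] by (simp add: norm_minus_commute)
  then show "- (norm (y - x))\<^sup>2 \<le> (infdist y C)\<^sup>2 - (infdist x C)\<^sup>2 - 2 * ((x - P x) \<bullet> (y - x))"
    using mono by (simp add: inner_diff_left inner_diff_right)
qed

lemma has_derivative_infdist_square:
  "((\<lambda>x. (infdist x C)\<^sup>2) has_derivative (\<lambda>v. (2 *\<^sub>R (x - P x)) \<bullet> v)) (at x)"
proof (rule has_derivative_inner_quadratic[where c = 1])
  show "\<bar>(infdist y C)\<^sup>2 - (infdist x C)\<^sup>2 - (2 *\<^sub>R (x - P x)) \<bullet> (y - x)\<bar> \<le> 1 * (norm (y - x))\<^sup>2" for y
    using infdist_square_bounds[of y x] by (simp only: abs_le_iff inner_scaleR_left) linarith
qed

text \<open>A convex potential of the projection \<open>P\<close>. Components of \<open>P\<close> need not be differentiable, but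
  they are uniform limits of difference quotients of this potential, which are.\<close>

definition moreau :: "'a \<Rightarrow> real" where
  "moreau x = ((norm x)\<^sup>2 - (infdist x C)\<^sup>2) / 2"

text \<open>Subtracting the expansions of the two squares leaves the gradient \<open>P x\<close>;
  the lower bound 0 expresses convexity of \<open>moreau\<close>.\<close>

lemma moreau_bounds:
  shows "0 \<le> moreau y - moreau x - P x \<bullet> (y - x)"
    and "moreau y - moreau x - P x \<bullet> (y - x) \<le> (norm (y - x))\<^sup>2"
proof -
  have "(norm y)\<^sup>2 - (norm x)\<^sup>2 = (norm (y - x))\<^sup>2 + 2 * (x \<bullet> (y - x))"
    by (simp add: power2_norm_eq_inner inner_diff_left inner_diff_right inner_commute)
  moreover have "(x - P x) \<bullet> (y - x) = x \<bullet> (y - x) - P x \<bullet> (y - x)"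
    by (rule inner_diff_left)
  ultimately show "0 \<le> moreau y - moreau x - P x \<bullet> (y - x)"
    "moreau y - moreau x - P x \<bullet> (y - x) \<le> (norm (y - x))\<^sup>2"
    using infdist_square_bounds[of y x] unfolding moreau_def diff_divide_distrib by linarith+
qed

lemma has_derivative_moreau: "(moreau has_derivative (\<lambda>v. P x \<bullet> v)) (at x)"
proof (rule has_derivative_inner_quadratic[where c = 1])
  show "\<bar>moreau y - moreau x - P x \<bullet> (y - x)\<bar> \<le> 1 * (norm (y - x))\<^sup>2" for y
    using moreau_bounds[of y x] by simp
qed

end

section \<open>Variance bounds for Lipschitz functions of a Gaussian vector\<close>

context gaussian_vector
begin

lemma integral_law:
  fixes \<phi> :: "real ^ 'n \<Rightarrow> real"
  assumes "\<phi> \<in> borel_measurable borel"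
  shows "(\<integral>x. \<phi> x \<partial>law) = expectation (\<lambda>w. \<phi> (g w))"
  using assms by (simp add: integral_distr)

lemma lipschitz_integrable:
  fixes H :: "real ^ 'n \<Rightarrow> real"
  assumes lip: "\<And>x y. \<bar>H x - H y\<bar> \<le> norm (x - y)"
  shows "H \<in> borel_measurable borel"
    and "integrable law H" and "integrable law (\<lambda>x. (H x)\<^sup>2)"
    and "integrable M (\<lambda>w. H (g w))" and "integrable M (\<lambda>w. (H (g w))\<^sup>2)"
proof -
  have "1-lipschitz_on UNIV H"
    using lip by (intro lipschitz_onI) (auto simp: dist_norm)
  then show meas[measurable]: "H \<in> borel_measurable borel"
    by (intro borel_measurable_continuous_onI lipschitz_on_continuous_on)
  have "(H x)\<^sup>2 \<le> 2 * (H 0)\<^sup>2 + 2 * (norm x)\<^sup>2" for x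
  proof -
    have "\<bar>H x\<bar> \<le> \<bar>H 0\<bar> + norm x" using lip[of x 0] by simp
    then have "(H x)\<^sup>2 \<le> (\<bar>H 0\<bar> + norm x)\<^sup>2"
      using power_mono[of "\<bar>H x\<bar>" "\<bar>H 0\<bar> + norm x" 2] by simp
    also have "\<dots> \<le> 2 * (H 0)\<^sup>2 + 2 * (norm x)\<^sup>2"
      using sum_squares_bound[of "\<bar>H 0\<bar>" "norm x"] by (simp add: power2_sum)
    finally show ?thesis .
  qed
  then have bound: "norm ((H x)\<^sup>2) \<le> norm (2 * (H 0)\<^sup>2 + 2 * (norm x)\<^sup>2)" for x
    by simp
  have int: "integrable law (\<lambda>x. 2 * (H 0)\<^sup>2 + 2 * (norm x)\<^sup>2)"
    using integrable_law_norm_square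
    by (intro Bochner_Integration.integrable_add integrable_mult_right law.integrable_const)
  show sq: "integrable law (\<lambda>x. (H x)\<^sup>2)"
    by (rule Bochner_Integration.integrable_bound[OF int _ AE_I2[OF bound]]) simp
  then show "integrable law H"
    by (rule law.square_integrable_imp_integrable[rotated]) simp
  then show "integrable M (\<lambda>w. H (g w))"
    by (rule integrable_distr[OF measurable_g])
  show "integrable M (\<lambda>w. (H (g w))\<^sup>2)"
    by (rule integrable_distr[OF measurable_g sq])
qed

text \<open>The cross term of the expanded square factors by independence. This converts
  \<open>pair_poincare\<close> into a bound on a variance.\<close>

lemma variance_symmetrization:
  fixes H :: "real ^ 'n \<Rightarrow> real"
  assumes lip: "\<And>x y. \<bar>H x - H y\<bar> \<le> norm (x - y)"
  shows "integrable (law \<Otimes>\<^sub>M law) (\<lambda>z. (H (fst z) - H (snd z))\<^sup>2)"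
    and "(\<integral>z. (H (fst z) - H (snd z))\<^sup>2 \<partial>(law \<Otimes>\<^sub>M law)) = 2 * variance (\<lambda>w. H (g w))"
proof -
  note int = lipschitz_integrable[OF lip]
  have cont: "continuous_on S H" for S
  proof -
    have "1-lipschitz_on S H"
      using lip by (intro lipschitz_onI) (auto simp: dist_norm)
    then show ?thesis by (rule lipschitz_on_continuous_on)
  qed
  have bound: "\<bar>H (fst z) - H (snd z)\<bar> \<le> 1 * (norm (fst z) + norm (snd z))" for z
    using order_trans[OF lip norm_triangle_ineq4] by simp
  have "(\<lambda>z. H (fst z) - H (snd z)) \<in> borel_measurable borel"
    by (intro borel_measurable_continuous_onI continuous_intros continuous_on_compose2[OF cont _ subset_UNIV])
  then show *: "integrable (law \<Otimes>\<^sub>M law) (\<lambda>z. (H (fst z) - H (snd z))\<^sup>2)"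
    by (rule integrable_pair_bound[OF _ bound])
  define e s where "e = (\<integral>x. H x \<partial>law)" and "s = (\<integral>x. (H x)\<^sup>2 \<partial>law)"
  have "(\<integral>y. (H x - H y)\<^sup>2 \<partial>law) = (H x)\<^sup>2 - 2 * e * H x + s" for x
  proof -
    have "(\<integral>y. (H x - H y)\<^sup>2 \<partial>law) = (\<integral>y. (H x)\<^sup>2 - 2 * H x * H y + (H y)\<^sup>2 \<partial>law)"
      by (simp add: power2_diff algebra_simps)
    also have "\<dots> = (H x)\<^sup>2 - 2 * H x * e + s"
      unfolding e_def s_def using int by (simp add: law.prob_space[simplified])
    finally show ?thesis by (simp add: algebra_simps)
  qed
  then have "(\<integral>z. (H (fst z) - H (snd z))\<^sup>2 \<partial>(law \<Otimes>\<^sub>M law)) = (\<integral>x. (H x)\<^sup>2 - 2 * e * H x + s \<partial>law)"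
    by (subst pair.integral_fst'[OF *, symmetric]) simp
  also have "\<dots> = 2 * (s - e\<^sup>2)"
    unfolding power2_eq_square[of e] using int
    by (simp add: law.prob_space[simplified]) (simp add: e_def s_def)
  also have "s - e\<^sup>2 = variance (\<lambda>w. H (g w))"
    using int by (subst variance_eq) (simp_all add: e_def s_def integral_law)
  finally show "(\<integral>z. (H (fst z) - H (snd z))\<^sup>2 \<partial>(law \<Otimes>\<^sub>M law)) = 2 * variance (\<lambda>w. H (g w))" .
qed

text \<open>\<open>pair_poincare\<close> asks for differentiability, which distances and projections
  may lack. A uniform approximation is enough, because \<open>(pi / 2)\<^sup>2 / 2\<close> is far
  enough below 2 to absorb the error.\<close>

lemma variance_le_approx:
  fixes H h :: "real ^ 'n \<Rightarrow> real"
  assumes lip: "\<And>x y. \<bar>H x - H y\<bar> \<le> norm (x - y)"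
    and der: "\<And>x. (h has_derivative (\<lambda>v. a x \<bullet> v)) (at x)"
    and a: "\<And>x. norm (a x) \<le> 1"
    and approx: "\<And>x. \<bar>H x - h x\<bar> \<le> 1 / 10"
  shows "variance (\<lambda>w. H (g w)) \<le> 2"
proof -
  have lip_h: "\<bar>h x - h y\<bar> \<le> norm (x - y)" for x y
    by (rule lipschitz_of_gradient_bound[OF der a])
  \<comment> \<open>The weights come from \<open>(u - 2 * v)\<^sup>2 \<ge> 0\<close>; with
    \<open>\<bar>v\<bar> \<le> 2 / 10\<close> the error term is at most
    \<open>3 * 4 / 100\<close>.\<close>
  have "(H x - H y)\<^sup>2 \<le> 3 / 2 * (h x - h y)\<^sup>2 + 12 / 100" for x y
  proof -
    define u v where "u = h x - h y" and "v = (H x - H y) - u"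
    have "\<bar>v\<bar> \<le> 2 / 10"
      using approx[of x] approx[of y] unfolding u_def v_def abs_le_iff by linarith
    then have "v\<^sup>2 \<le> (2 / 10)\<^sup>2"
      using power_mono[of "\<bar>v\<bar>" "2 / 10" 2] by simp
    moreover have "(u + v)\<^sup>2 \<le> 3 / 2 * u\<^sup>2 + 3 * v\<^sup>2"
      using zero_le_power2[of "u - 2 * v"] by (simp add: power2_eq_square algebra_simps)
    ultimately show ?thesis by (simp add: u_def v_def power2_eq_square)
  qed
  then have "(\<integral>z. (H (fst z) - H (snd z))\<^sup>2 \<partial>(law \<Otimes>\<^sub>M law))
      \<le> (\<integral>z. 3 / 2 * (h (fst z) - h (snd z))\<^sup>2 + 12 / 100 \<partial>(law \<Otimes>\<^sub>M law))"
    by (intro integral_mono variance_symmetrization lip lip_h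
        Bochner_Integration.integrable_add integrable_mult_right) simp_all
  also have "\<dots> = 3 / 2 * (\<integral>z. (h (fst z) - h (snd z))\<^sup>2 \<partial>(law \<Otimes>\<^sub>M law)) + 12 / 100"
    using variance_symmetrization(1)[OF lip_h] by (simp add: pair.prob_space[simplified])
  also have "\<dots> \<le> 3 / 2 * (pi / 2)\<^sup>2 + 12 / 100"
    using pair_poincare[OF der a] by simp
  \<comment> \<open>The bound 4 is twice the claimed variance; \<open>pi \<le> 3.2\<close> gives
    3.96.\<close>
  also have "\<dots> \<le> 4"
  proof -
    have "pi\<^sup>2 \<le> (32 / 10)\<^sup>2"
      using pi_approx by (intro power_mono) auto
    then show ?thesis by (simp add: power2_eq_square)
  qed
  finally show ?thesis using variance_symmetrization(2)[OF lip] by simp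
qed

lemma variance_infdist_le:
  assumes "closed C" "convex C" "C \<noteq> {}"
  shows "variance (\<lambda>w. infdist (g w) C) \<le> 2"
proof -
  interpret closed_convex C by unfold_locales fact+
  \<comment> \<open>The distance may have a kink at the boundary of \<open>C\<close>. The gradient
    of \<open>r\<close> has norm \<open>infdist x C / r x\<close>, at most 1, and \<open>r\<close>
    exceeds the distance by at most \<open>1 / 10\<close>.\<close>
  define r where "r x = sqrt ((infdist x C)\<^sup>2 + (1 / 10)\<^sup>2)" for x
  have r_pos: "0 < r x" and r_ge: "infdist x C \<le> r x" for x
    unfolding r_def by (simp_all add: add_nonneg_pos real_le_rsqrt)
  show ?thesis
  proof (rule variance_le_approx[OF infdist_lipschitz])
    fix x
    show "(r has_derivative (\<lambda>v. ((1 / r x) *\<^sub>R (x - P x)) \<bullet> v)) (at x)"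
      unfolding r_def
      by (rule derivative_eq_intros has_derivative_infdist_square refl | simp add: add_nonneg_pos)+
        (simp add: field_simps fun_eq_iff)
    show "norm ((1 / r x) *\<^sub>R (x - P x)) \<le> 1"
      using r_pos[of x] r_ge[of x] by (simp add: infdist_eq)
    have "r x \<le> infdist x C + 1 / 10"
      unfolding r_def using infdist_nonneg[of x C] by (intro real_le_lsqrt) (simp_all add: power2_sum)
    then show "\<bar>infdist x C - r x\<bar> \<le> 1 / 10"
      using r_ge[of x] by simp
  qed
qed

lemma variance_closest_point_le:
  assumes "closed C" "convex C" "C \<noteq> {}" and u: "norm u = 1"
  shows "variance (\<lambda>w. closest_point C (g w) \<bullet> u) \<le> 2"
proof -
  interpret closed_convex C by unfold_locales fact+
  define e :: real where "e = 1 / 10"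
  have e: "e > 0" by (simp add: e_def)
  \<comment> \<open>Nonexpansiveness of \<open>P\<close> bounds the gradient of this difference
    quotient by 1; the quadratic remainder of \<open>moreau\<close> keeps it within the step length
    \<open>e\<close> of \<open>P x \<bullet> u\<close>.\<close>
  define h where "h x = (moreau (x + e *\<^sub>R u) - moreau x) / e" for x
  show ?thesis
  proof (rule variance_le_approx)
    show "\<bar>P x \<bullet> u - P y \<bullet> u\<bar> \<le> norm (x - y)" for x y
    proof -
      have "\<bar>(P x - P y) \<bullet> u\<bar> \<le> norm (P x - P y) * norm u"
        by (rule Cauchy_Schwarz_ineq2)
      then show ?thesis using P_lipschitz[of x y] u by (simp add: inner_diff_left)
    qed
  next
    fix x
    have "((\<lambda>x. moreau (x + e *\<^sub>R u)) has_derivative (\<lambda>v. P (x + e *\<^sub>R u) \<bullet> v)) (at x)"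
      by (rule has_derivative_compose[OF _ has_derivative_moreau]) (auto intro!: derivative_eq_intros)
    then have "(h has_derivative (\<lambda>v. (P (x + e *\<^sub>R u) \<bullet> v - P x \<bullet> v) / e)) (at x)"
      unfolding h_def using e by (auto intro!: derivative_eq_intros has_derivative_moreau)
    then show "(h has_derivative (\<lambda>v. ((1 / e) *\<^sub>R (P (x + e *\<^sub>R u) - P x)) \<bullet> v)) (at x)"
      by (simp add: inner_diff_left)
    show "norm ((1 / e) *\<^sub>R (P (x + e *\<^sub>R u) - P x)) \<le> 1"
      using P_lipschitz[of "x + e *\<^sub>R u" x] e u by simp
    have "h x - P x \<bullet> u = (moreau (x + e *\<^sub>R u) - moreau x - P x \<bullet> (e *\<^sub>R u)) / e"
      using e by (simp add: h_def field_simps)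
    moreover have "0 \<le> \<dots>" "\<dots> \<le> e\<^sup>2 / e"
      using moreau_bounds[where x = x and y = "x + e *\<^sub>R u"] e u
      by (intro divide_nonneg_pos divide_right_mono, simp_all)+
    ultimately show "\<bar>P x \<bullet> u - h x\<bar> \<le> 1 / 10"
      by (simp add: e_def power2_eq_square)
  qed
qed

end

subsection \<open>The polar of the descent cone\<close>

lemma cone_of_eq_cone_hull: "cone_of S = cone hull S"
  by (auto simp: cone_of_def cone_hull_expl)

locale subdifferentiable =
  fixes f :: "'a::euclidean_space \<Rightarrow> ereal" and x :: 'a
  assumes proper: "proper_fun f" and convex_f: "convex_fun f"
    and nonempty: "subdifferential f x \<noteq> {}"
begin

abbreviation S :: "'a set" where "S \<equiv> subdifferential f x"

definition fx :: real where "fx = real_of_ereal (f x)"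

text \<open>A subgradient inequality at a point of finite value bounds \<open>f x\<close> from
  above; properness excludes the other infinity.\<close>

lemma f_x: "f x = ereal fx"
proof -
  obtain y where "f y \<noteq> \<infinity>" using proper by (auto simp: proper_fun_def)
  moreover obtain z where "f x + ereal (z \<bullet> (y - x)) \<le> f y"
    using nonempty by (auto simp: subdifferential_def)
  moreover have "f x \<noteq> -\<infinity>" using proper by (auto simp: proper_fun_def)
  ultimately show ?thesis by (cases "f x") (auto simp: fx_def)
qed

lemma f_finite_or_infinite: obtains "f y = \<infinity>" | r where "f y = ereal r"
  using proper by (cases "f y") (auto simp: proper_fun_def)

lemma mem_S: "z \<in> S \<longleftrightarrow> (\<forall>y r. f y = ereal r \<longrightarrow> fx + z \<bullet> (y - x) \<le> r)"
proof
  show "\<forall>y r. f y = ereal r \<longrightarrow> fx + z \<bullet> (y - x) \<le> r" if "z \<in> S"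
    using that by (auto simp: subdifferential_def f_x) (metis ereal_less_eq(3))
  show "z \<in> S" if *: "\<forall>y r. f y = ereal r \<longrightarrow> fx + z \<bullet> (y - x) \<le> r"
    unfolding subdifferential_def
  proof (intro CollectI allI)
    fix y
    show "f x + ereal (z \<bullet> (y - x)) \<le> f y"
      using * by (cases y rule: f_finite_or_infinite) (auto simp: f_x)
  qed
qed

text \<open>Written with half-spaces, the set is visibly closed and convex.\<close>

lemma S_eq_Inter: "S = (\<Inter>y\<in>{y. \<exists>r. f y = ereal r}. {z. (y - x) \<bullet> z \<le> real_of_ereal (f y) - fx})"
proof (rule set_eqI)
  fix z
  show "z \<in> S \<longleftrightarrow> z \<in> (\<Inter>y\<in>{y. \<exists>r. f y = ereal r}. {z. (y - x) \<bullet> z \<le> real_of_ereal (f y) - fx})"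
    unfolding mem_S by (auto simp: inner_commute[of z] algebra_simps)
qed

lemma closed_S: "closed S" and convex_S: "convex S"
  unfolding S_eq_Inter
  by (intro closed_INT convex_INT ballI closed_halfspace_le convex_halfspace_le)+

text \<open>The epigraph of \<open>f\<close>, translated so that \<open>(x, fx)\<close> becomes the
  origin.\<close>

definition epi :: "('a \<times> real) set" where
  "epi = {(y, r). f (x + y) \<le> ereal (fx + r)}"

lemma convex_epi: "convex epi"
proof (rule convexI, safe)
  fix y r y' r' and u v :: real
  assume y: "(y, r) \<in> epi" and y': "(y', r') \<in> epi" and uv: "0 \<le> u" "0 \<le> v" "u + v = 1"
  show "u *\<^sub>R (y, r) + v *\<^sub>R (y', r') \<in> epi"
  \<comment> \<open>\<open>convex_fun\<close> speaks of positive weights only, so the end points are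
    treated apart.\<close>
  proof (cases "u = 0 \<or> v = 0")
    case True
    then show ?thesis using y y' uv by auto
  next
    case False
    then have pos: "0 < u" "0 < v" using uv by auto
    have "x + (u *\<^sub>R y + v *\<^sub>R y') = u *\<^sub>R (x + y) + v *\<^sub>R (x + y')"
      using scaleR_left_distrib[of u v x] uv(3) by (simp add: algebra_simps)
    then have "f (x + (u *\<^sub>R y + v *\<^sub>R y')) \<le> ereal u * f (x + y) + ereal v * f (x + y')"
      using convex_f pos uv(3) by (simp add: convex_fun_def)
    also have "\<dots> \<le> ereal u * ereal (fx + r) + ereal v * ereal (fx + r')"
      using y y' pos by (intro add_mono ereal_mult_left_mono) (auto simp: epi_def)
    also have "\<dots> = ereal ((u + v) * fx + (u * r + v * r'))"
      by (simp add: algebra_simps)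
    finally show ?thesis by (simp add: epi_def uv(3))
  qed
qed

lemma mem_descent_cone: "w \<in> descent_cone f x \<longleftrightarrow> (\<exists>t>0. f (x + t *\<^sub>R w) \<le> f x)"
  by (auto simp: descent_cone_def)

lemma zero_mem_descent_cone: "0 \<in> descent_cone f x"
  unfolding mem_descent_cone by (intro exI[of _ 1]) simp

lemma scaleR_mem_descent_cone:
  assumes "w \<in> descent_cone f x" "0 < c"
  shows "c *\<^sub>R w \<in> descent_cone f x"
proof -
  obtain t where "t > 0" "f (x + t *\<^sub>R w) \<le> f x"
    using assms(1) unfolding mem_descent_cone by blast
  then show ?thesis
    using assms(2) unfolding mem_descent_cone by (intro exI[of _ "t / c"]) simp
qed

lemma descent_cone_of_epi:
  assumes "(w, \<rho>) \<in> cone hull epi" "\<rho> \<le> 0"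
  shows "w \<in> descent_cone f x"
proof -
  obtain k y r where k: "0 \<le> k" "(y, r) \<in> epi" "w = k *\<^sub>R y" "\<rho> = k * r"
    using assms(1) by (auto simp: cone_hull_expl)
  show ?thesis
  proof (cases "k = 0")
    case True
    then show ?thesis using k zero_mem_descent_cone by simp
  next
    case False
    then have "r \<le> 0" using k(1,4) assms(2) by (simp add: mult_le_0_iff)
    then have "f (x + y) \<le> f x"
      using k(2) order_trans[of "f (x + y)" "ereal (fx + r)" "ereal fx"] by (simp add: epi_def f_x)
    then have "y \<in> descent_cone f x"
      unfolding mem_descent_cone by (intro exI[of _ 1]) simp
    then show ?thesis
      using False k by (auto intro: scaleR_mem_descent_cone)
  qed
qed

text \<open>Otherwise a hyperplane with normal \<open>(p, s)\<close> and \<open>s \<ge> 0\<close>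
  separates the point from the cone. If \<open>s > 0\<close>, rescaling \<open>p\<close> gives a
  subgradient that violates polarity. If \<open>s = 0\<close>, \<open>- p\<close> is a recession
  direction of \<open>S\<close>, and moving far along it violates polarity.\<close>

lemma polar_mem_closure_cone_hull_epi:
  assumes polar: "\<And>z. z \<in> S \<Longrightarrow> v \<bullet> z \<le> 0"
  shows "(v, 0) \<in> closure (cone hull epi)"
proof (rule ccontr)
  assume "(v, 0) \<notin> closure (cone hull epi)"
  then obtain a b where a: "a \<bullet> (v, 0) < b" "\<And>e. e \<in> closure (cone hull epi) \<Longrightarrow> b < a \<bullet> e"
    using separating_hyperplane_closed_point[of "closure (cone hull epi)" "(v, 0)"]
      convex_closure[OF convex_cone_hull[OF convex_epi]] by blast
  obtain p s where ps: "a = (p, s)" by fastforce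
  have "(0, 0) \<in> epi" by (simp add: epi_def f_x)
  then have "0 \<in> closure (cone hull epi)"
    using closure_subset[of "cone hull epi"] hull_subset[of epi cone] by (auto simp: zero_prod_def)
  then have b: "b < 0" using a(2) by fastforce
  have nonneg: "0 \<le> p \<bullet> y + s * r" if "(y, r) \<in> epi" for y r
  proof (rule ccontr)
    assume neg: "\<not> 0 \<le> p \<bullet> y + s * r"
    \<comment> \<open>Scaling a point of negative value by \<open>k\<close> gives the value
      \<open>b\<close> itself, against strict separation.\<close>
    define k where "k = b / (p \<bullet> y + s * r)"
    have "0 \<le> k" using neg b by (simp add: k_def divide_nonpos_neg)
    then have "k *\<^sub>R (y, r) \<in> cone hull epi" using that by (intro mem_cone_hull)
    then have "b < a \<bullet> (k *\<^sub>R (y, r))" using closure_subset a(2) by blast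
    also have "\<dots> = k * (p \<bullet> y + s * r)" by (simp add: ps algebra_simps)
    also have "\<dots> = b" using neg by (simp add: k_def)
    finally show False by simp
  qed
  have pv: "p \<bullet> v < 0" using a(1) b by (simp add: ps)
  have epiI: "(y - x, r - fx) \<in> epi" if "f y = ereal r" for y r
    using that by (simp add: epi_def)
  have "s \<ge> 0"
    using nonneg[of 0 1] by (simp add: epi_def f_x)
  then consider "s > 0" | "s = 0" by linarith
  then show False
  proof cases
    case 1
    have "(-1 / s) *\<^sub>R p \<in> S"
      unfolding mem_S
    proof (intro allI impI)
      fix y r assume "f y = ereal r"
      then have "0 \<le> p \<bullet> (y - x) + s * (r - fx)" by (intro nonneg epiI)
      then show "fx + ((-1 / s) *\<^sub>R p) \<bullet> (y - x) \<le> r" using 1 by (simp add: field_simps)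
    qed
    then have "- (p \<bullet> v) / s \<le> 0" using polar by (fastforce simp: inner_commute)
    moreover have "0 < - (p \<bullet> v) / s" using pv 1 by (intro divide_pos_pos) auto
    ultimately show False by simp
  next
    case 2
    obtain z where z: "z \<in> S" using nonempty by blast
    \<comment> \<open>This \<open>k\<close> makes \<open>v \<bullet> (z - k *\<^sub>R p)\<close>
      equal to \<open>v \<bullet> z + \<bar>v \<bullet> z\<bar> + 1\<close>, which is at least
      1.\<close>
    define k where "k = (\<bar>v \<bullet> z\<bar> + 1) / - (p \<bullet> v)"
    have k: "k \<ge> 0" using pv by (simp add: k_def divide_nonneg_neg)
    have "z - k *\<^sub>R p \<in> S"
      unfolding mem_S
    proof (intro allI impI)
      fix y r assume y: "f y = ereal r"
      then have "0 \<le> p \<bullet> (y - x)" using nonneg[OF epiI[OF y]] 2 by simp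
      then have "0 \<le> k * (p \<bullet> (y - x))" using k by simp
      moreover have "fx + z \<bullet> (y - x) \<le> r" using z y by (simp add: mem_S)
      ultimately show "fx + (z - k *\<^sub>R p) \<bullet> (y - x) \<le> r" by (simp add: inner_diff_left)
    qed
    then have "v \<bullet> z - k * (p \<bullet> v) \<le> 0"
      using polar[of "z - k *\<^sub>R p"] by (simp add: inner_diff_right inner_commute)
    moreover have "k * (p \<bullet> v) = - (\<bar>v \<bullet> z\<bar> + 1)" using pv by (simp add: k_def)
    ultimately show False by simp
  qed
qed

text \<open>A point of the closed cone generated by the epigraph is pushed below level zero by adding a
  small multiple of a direction of strict descent, which exists since \<open>0\<close> is not a subgradient.\<close>

lemma polar_mem_closure_descent_cone:
  assumes "0 \<notin> S" and polar: "\<And>z. z \<in> S \<Longrightarrow> v \<bullet> z \<le> 0"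
  shows "v \<in> closure (descent_cone f x)"
proof -
  obtain y r where y: "f y = ereal r" "r < fx"
    using assms(1) unfolding mem_S by (auto simp: not_le)
  define u \<delta> where "u = y - x" and "\<delta> = fx - r"
  have u: "(u, - \<delta>) \<in> cone hull epi"
    using y hull_subset[of epi cone] by (auto simp: u_def \<delta>_def epi_def)
  have \<delta>: "\<delta> > 0" using y by (simp add: \<delta>_def)
  have add: "a + b \<in> cone hull epi" if "a \<in> cone hull epi" "b \<in> cone hull epi" for a b
    using convex_cone[of "cone hull epi"] convex_cone_hull[OF convex_epi] cone_cone_hull that by blast
  obtain e where e: "\<And>n. e n \<in> cone hull epi" "e \<longlonglongrightarrow> (v, 0)"
    using polar_mem_closure_cone_hull_epi[OF polar] unfolding closure_sequential by blast
  \<comment> \<open>The added multiple of \<open>(u, - \<delta>)\<close> lowers the height of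
    \<open>e n\<close> by its absolute value, so the result is nonpositive for either sign. The
    multiple vanishes in the limit because the heights tend to 0.\<close>
  define w where "w n = fst (e n) + (\<bar>snd (e n)\<bar> / \<delta>) *\<^sub>R u" for n
  have "w n \<in> descent_cone f x" for n
  proof (rule descent_cone_of_epi)
    have "(\<bar>snd (e n)\<bar> / \<delta>) *\<^sub>R (u, - \<delta>) \<in> cone hull epi"
      using \<delta> by (intro mem_cone[OF cone_cone_hull u]) simp
    from add[OF e(1)[of n] this] show "(w n, snd (e n) - \<bar>snd (e n)\<bar>) \<in> cone hull epi"
      using \<delta> by (cases "e n") (simp add: w_def)
  qed simp
  moreover have "w \<longlonglongrightarrow> v + (\<bar>0\<bar> / \<delta>) *\<^sub>R u"
    unfolding w_def using tendsto_fst[OF e(2)] tendsto_snd[OF e(2)] \<delta>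
    by (intro tendsto_intros) auto
  ultimately show ?thesis
    unfolding closure_sequential by auto
qed

text \<open>The generated cone need not be closed; its closure admits a projection and leaves
  distances unchanged.\<close>

definition K :: "'a set" where "K = closure (cone_of S)"

lemma closed_K: "closed K" and convex_K: "convex K" and cone_K: "cone K"
  unfolding K_def cone_of_eq_cone_hull
  by (rule closed_closure convex_closure[OF convex_cone_hull[OF convex_S]]
      cone_closure[OF cone_cone_hull])+

lemma S_subset_K: "S \<subseteq> K"
  unfolding K_def cone_of_eq_cone_hull by (rule order_trans[OF hull_subset closure_subset])

lemma K_nonempty: "K \<noteq> {}"
  using S_subset_K nonempty by blast

lemma infdist_cone_of: "infdist w (cone_of S) = infdist w K"
  by (simp add: K_def infdist_eq_setdist)

text \<open>By Moreau's decomposition the residual \<open>w - P w\<close> lies in the polar of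
  \<open>K\<close>, hence in the closure of the descent cone, and its direction approaches the
  supremum. The subgradient inequality and Cauchy-Schwarz give the other bound.\<close>

lemma SUP_descent_cone:
  assumes "0 \<notin> S"
  shows "(SUP y\<in>descent_cone f x \<inter> cball 0 1. y \<bullet> w) = infdist w (cone_of S)"
proof (rule antisym)
  let ?D = "descent_cone f x \<inter> cball 0 1"
  have upper: "y \<bullet> w \<le> infdist w (cone_of S)" if y: "y \<in> ?D" for y
  proof -
    obtain t where t: "t > 0" "f (x + t *\<^sub>R y) \<le> f x"
      using y by (auto simp: mem_descent_cone)
    have "y \<bullet> w \<le> dist w q" if q: "q \<in> cone_of S" for q
    proof -
      obtain s z where s: "0 \<le> s" "z \<in> S" "q = s *\<^sub>R z"
        using q by (auto simp: cone_of_def)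
      obtain r where r: "f (x + t *\<^sub>R y) = ereal r"
        using t(2) by (cases "x + t *\<^sub>R y" rule: f_finite_or_infinite) (auto simp: f_x)
      then have "fx + z \<bullet> (t *\<^sub>R y) \<le> r" using s(2) unfolding mem_S by fastforce
      then have "t * (z \<bullet> y) \<le> 0" using t(2) r by (simp add: f_x)
      then have "z \<bullet> y \<le> 0" using t(1) by (simp add: mult_le_0_iff)
      then have "y \<bullet> q \<le> 0" using s by (simp add: inner_commute mult_nonneg_nonpos)
      moreover have "y \<bullet> (w - q) \<le> norm y * norm (w - q)" by (rule norm_cauchy_schwarz)
      moreover have "norm y * norm (w - q) \<le> 1 * norm (w - q)"
        using y by (intro mult_right_mono) auto
      ultimately show ?thesis by (simp add: inner_diff_right dist_norm)
    qed
    moreover have "cone_of S \<noteq> {}"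
      using K_nonempty by (auto simp: K_def)
    ultimately show ?thesis by (simp add: infdist_notempty cINF_greatest)
  qed
  have D: "0 \<in> ?D" using zero_mem_descent_cone by simp
  show "(SUP y\<in>?D. y \<bullet> w) \<le> infdist w (cone_of S)"
    using D upper by (intro cSUP_least) auto
  have bdd: "bdd_above ((\<lambda>y. y \<bullet> w) ` ?D)"
    using upper by (intro bdd_aboveI2)
  interpret closed_convex K
    using closed_K convex_K K_nonempty by unfold_locales
  define v where "v = w - P w"
  have dot: "v \<bullet> (q - P w) \<le> 0" if "q \<in> K" for q
    unfolding v_def by (rule closest_point_dot[OF convex_K closed_K that])
  have K_add: "P w + q \<in> K" if "q \<in> K" for q
    using convex_cone[of K] convex_K cone_K P_in that by blast
  \<comment> \<open>Obtained by testing \<open>dot\<close> with the cone points \<open>0\<close> and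
    \<open>P w + P w\<close>.\<close>
  have vP: "v \<bullet> P w = 0"
    using dot[OF mem_cone[OF cone_K P_in[of w], of 0]] dot[OF K_add[OF P_in[of w]]]
    by simp
  have vz: "v \<bullet> z \<le> 0" if "z \<in> S" for z
    using dot[OF K_add, of z] S_subset_K that by auto
  have vw: "v \<bullet> w = (norm v)\<^sup>2"
    using vP by (simp add: v_def power2_norm_eq_inner inner_diff_right)
  have "norm v \<le> (SUP y\<in>?D. y \<bullet> w)"
  proof (cases "v = 0")
    case True
    then show ?thesis using cSUP_upper[OF D bdd] by simp
  next
    case False
    have "((1 / norm v) *\<^sub>R v) \<bullet> z \<le> 0" if "z \<in> S" for z
      using vz[OF that] by (simp add: divide_le_0_iff)
    then have "(1 / norm v) *\<^sub>R v \<in> closure (descent_cone f x)"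
      by (rule polar_mem_closure_descent_cone[OF assms])
    then obtain y where y: "\<And>n. y n \<in> descent_cone f x" "y \<longlonglongrightarrow> (1 / norm v) *\<^sub>R v"
      unfolding closure_sequential by blast
    \<comment> \<open>The approximants may leave the unit ball. This rescaling brings them back
      within the cone and keeps the limit, which has norm 1.\<close>
    define y' where "y' n = (1 / max 1 (norm (y n))) *\<^sub>R y n" for n
    have "y' n \<in> ?D" for n
      using y(1)[of n] unfolding y'_def by (auto intro!: scaleR_mem_descent_cone simp: field_simps max_def)
    then have le: "y' n \<bullet> w \<le> (SUP y\<in>?D. y \<bullet> w)" for n
      using cSUP_upper[OF _ bdd] by blast
    have "y' \<longlonglongrightarrow> (1 / max 1 (norm ((1 / norm v) *\<^sub>R v))) *\<^sub>R ((1 / norm v) *\<^sub>R v)"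
      unfolding y'_def by (intro tendsto_intros y(2)) (simp add: max_def)
    then have "y' \<longlonglongrightarrow> (1 / norm v) *\<^sub>R v" using False by simp
    then have "(\<lambda>n. y' n \<bullet> w) \<longlonglongrightarrow> ((1 / norm v) *\<^sub>R v) \<bullet> w" by (intro tendsto_intros)
    moreover have "((1 / norm v) *\<^sub>R v) \<bullet> w = norm v"
      using False vw by (simp add: power2_eq_square)
    ultimately show ?thesis
      using le by (intro LIMSEQ_le_const2[of "\<lambda>n. y' n \<bullet> w"]) auto
  qed
  then show "infdist w (cone_of S) \<le> (SUP y\<in>?D. y \<bullet> w)"
    by (simp add: infdist_cone_of infdist_eq v_def)
qed

end

subsection \<open>From pointwise bounds to expectations\<close>

context prob_space
begin

text \<open>Cauchy-Schwarz for the covariance of \<open>X\<close> with the indicator of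
  \<open>A\<close>, whose variance is \<open>prob A * (1 - prob A)\<close>; it is read off from a
  nonnegative quadratic in \<open>t\<close>.\<close>

lemma covariance_indicator_le:
  assumes X: "integrable M X" "integrable M (\<lambda>w. (X w)\<^sup>2)"
    and var: "variance X \<le> c" and A: "A \<in> events"
  shows "(\<integral>w. (X w - expectation X) * indicator A w \<partial>M)\<^sup>2 \<le> c * (prob A * (1 - prob A))"
proof -
  define m q where "m = expectation X" and "q = prob A"
  define e where "e = (\<integral>w. (X w - m) * indicator A w \<partial>M)"
  have int_sq: "integrable M (\<lambda>w. (X w - m)\<^sup>2)"
    using X by (simp add: power2_diff)
  have int_A: "integrable M (\<lambda>w. (X w - m) * indicator A w)"
    using X A by (intro integrable_real_mult_indicator) auto
  have ind: "integrable M (indicator A :: _ \<Rightarrow> real)" "(\<integral>w. indicator A w \<partial>M) = q"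
    using A by (simp_all add: q_def emeasure_eq_measure)
  have quad: "0 \<le> variance X - 2 * t * e + t\<^sup>2 * (q * (1 - q))" for t
  proof -
    have eq: "((X w - m) - t * (indicator A w - q))\<^sup>2
        = (X w - m)\<^sup>2 - 2 * t * ((X w - m) * indicator A w) + 2 * t * q * (X w - m)
          + t\<^sup>2 * ((1 - 2 * q) * indicator A w + q\<^sup>2)" for w
      by (cases "w \<in> A") (simp_all add: power2_eq_square algebra_simps)
    have "0 \<le> (\<integral>w. ((X w - m) - t * (indicator A w - q))\<^sup>2 \<partial>M)"
      by simp
    also have "\<dots> = variance X - 2 * t * e + t\<^sup>2 * ((1 - 2 * q) * q + q\<^sup>2)"
      unfolding eq using int_sq int_A ind X(1)
      by (simp add: prob_space e_def m_def)
    also have "(1 - 2 * q) * q + q\<^sup>2 = q * (1 - q)"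
      by (simp add: power2_eq_square algebra_simps)
    finally show ?thesis .
  qed
  have q: "0 \<le> q" "q \<le> 1" by (simp_all add: q_def)
  have "0 \<le> variance X" by simp
  then have c: "0 \<le> c" using var by (rule order_trans)
  have "e\<^sup>2 \<le> c * (q * (1 - q))"
  proof (cases "q * (1 - q) = 0")
    case True
    have "e = 0"
    proof (rule ccontr)
      assume "e \<noteq> 0"
      \<comment> \<open>In the degenerate case the quadratic is affine in \<open>t\<close>; this
        \<open>t\<close> lowers it to \<open>variance X - (c + 1)\<close>, which is
        negative.\<close>
      then show False using quad[of "(c + 1) / (2 * e)"] True var by simp
    qed
    then show ?thesis unfolding True by simp
  next
    case False
    then have pos: "0 < q * (1 - q)" using q by (simp add: less_le)
    have "0 \<le> variance X - e\<^sup>2 / (q * (1 - q))"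
      using quad[of "e / (q * (1 - q))"] False by (simp add: power2_eq_square)
    then have "e\<^sup>2 / (q * (1 - q)) \<le> c" using var by simp
    then show ?thesis using pos by (simp add: pos_divide_le_eq)
  qed
  then show ?thesis by (simp add: e_def m_def q_def)
qed

text \<open>Off the event \<open>T < E T + l\<close> the bound on \<open>F - G\<close> is lost, but by Cantelli's inequality and
  Cauchy-Schwarz that event contributes to every centred variable at most \<open>2 p / l\<close>, where \<open>p\<close> is
  the probability of \<open>T < E T + l\<close>.\<close>

lemma expectation_diff_le:
  fixes F G T :: "'a \<Rightarrow> real"
  assumes F: "integrable M F" "integrable M (\<lambda>w. (F w)\<^sup>2)" "variance F \<le> 2"
    and G: "integrable M G" "integrable M (\<lambda>w. (G w)\<^sup>2)" "variance G \<le> 2"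
    and T: "integrable M T" "integrable M (\<lambda>w. (T w)\<^sup>2)" "variance T \<le> 2"
    and le: "\<And>w. T w < expectation T + l \<Longrightarrow> F w \<le> G w + (expectation T + l - T w) * b"
    and l: "0 < l" and b: "0 \<le> b"
  shows "expectation F - expectation G \<le> b * (l + 2 / l) + 4 / l"
proof -
  define A where "A = {w \<in> space M. expectation T + l \<le> T w}"
  have [measurable]: "T \<in> borel_measurable M"
    using T(1) by (rule borel_measurable_integrable)
  have A: "A \<in> events"
    unfolding A_def by measurable
  define q p where "q = prob A" and "p = 1 - q"
  define cen where "cen X = (\<integral>w. (X w - expectation X) * indicator A w \<partial>M)" for X :: "'a \<Rightarrow> real"
  have cen_sq: "(cen X)\<^sup>2 \<le> 2 * (q * p)" if "integrable M X" "integrable M (\<lambda>w. (X w)\<^sup>2)" "variance X \<le> 2" for X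
    unfolding cen_def p_def q_def by (rule covariance_indicator_le[OF that A])
  have intA: "integrable M (\<lambda>w. (X w - c) * indicator A w)" if "integrable M X" for X :: "'a \<Rightarrow> real" and c
    using that A by (intro integrable_real_mult_indicator) auto
  have ind: "integrable M (indicator A :: _ \<Rightarrow> real)" "(\<integral>w. indicator A w \<partial>M) = q"
    using A by (simp_all add: q_def emeasure_eq_measure)
  have q: "0 \<le> q" "q \<le> 1" by (simp_all add: q_def)
  \<comment> \<open>Cantelli's inequality: on \<open>A\<close> the centred \<open>T\<close> is at
    least \<open>l\<close>, and the covariance bound turns \<open>l * q \<le> cen T\<close> into
    \<open>l\<^sup>2 * q \<le> 2 * p\<close>, which forces \<open>p > 0\<close>.\<close>
  have "l * q = (\<integral>w. l * indicator A w \<partial>M)" using ind by simp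
  also have "\<dots> \<le> cen T"
    unfolding cen_def
  proof (rule integral_mono)
    show "integrable M (\<lambda>w. l * indicator A w)" using ind(1) by (rule integrable_mult_right)
    show "l * indicator A w \<le> (T w - expectation T) * indicator A w" for w
      by (cases "w \<in> A") (simp_all add: A_def)
  qed (rule intA[OF T(1)])
  finally have "(l * q)\<^sup>2 \<le> (cen T)\<^sup>2"
    using l q by (intro power_mono) auto
  with cen_sq[OF T] have "q * (l\<^sup>2 * q) \<le> q * (2 * p)"
    by (simp add: power2_eq_square algebra_simps)
  then have lq: "l\<^sup>2 * q \<le> 2 * p"
    using q by (cases "q = 0") (auto simp: p_def)
  have p: "0 < p"
  proof (rule ccontr)
    assume "\<not> 0 < p"
    then have "q = 1" using q by (simp add: p_def)
    then show False using lq l by (simp add: p_def)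
  qed
  \<comment> \<open>Inserting \<open>q \<le> 2 * p / l\<^sup>2\<close> into
    \<open>2 * (q * p)\<close> gives the square of \<open>2 * p / l\<close>; the factor
    \<open>p\<close> is kept because it cancels at the end.\<close>
  have cen_le: "\<bar>cen X\<bar> \<le> 2 * p / l" if "integrable M X" "integrable M (\<lambda>w. (X w)\<^sup>2)" "variance X \<le> 2" for X
  proof (rule abs_le_square_iff[THEN iffD2, of "cen X" "2 * p / l", THEN order_trans])
    have "l\<^sup>2 * (cen X)\<^sup>2 \<le> l\<^sup>2 * (2 * (q * p))"
      using cen_sq[OF that] by (intro mult_left_mono) auto
    also have "\<dots> = 2 * p * (l\<^sup>2 * q)" by simp
    also have "\<dots> \<le> 2 * p * (2 * p)"
      using lq p by (intro mult_left_mono) auto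
    finally show "(cen X)\<^sup>2 \<le> (2 * p / l)\<^sup>2"
      using l by (simp add: power_divide power2_eq_square field_simps)
  qed (use p l in simp)
  define d where "d = expectation F - expectation G"
  \<comment> \<open>On \<open>A\<close> both sides vanish. Off \<open>A\<close> this is the
    hypothesis in centred variables, whose integrals off \<open>A\<close> are the negatives of those
    over \<open>A\<close>.\<close>
  have bound: "d * (1 - indicator A w)
      \<le> b * (l * (1 - indicator A w) + ((T w - expectation T) * indicator A w - (T w - expectation T)))
        + ((F w - expectation F) * indicator A w - (F w - expectation F))
        - ((G w - expectation G) * indicator A w - (G w - expectation G))" if "w \<in> space M" for w
    using le[of w] that by (cases "w \<in> A") (auto simp: A_def d_def algebra_simps)
  have "d * p = (\<integral>w. d * (1 - indicator A w) \<partial>M)"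
    using ind by (simp add: p_def prob_space)
  also have "\<dots> \<le> (\<integral>w. b * (l * (1 - indicator A w) + ((T w - expectation T) * indicator A w - (T w - expectation T)))
        + ((F w - expectation F) * indicator A w - (F w - expectation F))
        - ((G w - expectation G) * indicator A w - (G w - expectation G)) \<partial>M)"
    using F(1) G(1) T(1) ind(1) bound
    by (intro integral_mono Bochner_Integration.integrable_add Bochner_Integration.integrable_diff
        integrable_mult_right intA integrable_const)
  also have "\<dots> = b * (l * p + cen T) + cen F - cen G"
    using F(1) G(1) T(1) ind intA[OF F(1)] intA[OF G(1)] intA[OF T(1)]
    by (simp add: cen_def p_def prob_space)
  also have "\<dots> \<le> b * (l * p + 2 * p / l) + 2 * p / l + 2 * p / l"
  proof -
    have "b * (l * p + cen T) \<le> b * (l * p + 2 * p / l)"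
      using cen_le[OF T] b by (intro mult_left_mono) auto
    then show ?thesis using cen_le[OF F] cen_le[OF G] by linarith
  qed
  also have "\<dots> = (b * (l + 2 / l) + 4 / l) * p"
    using l by (simp add: field_simps)
  finally show ?thesis using p by (simp add: d_def)
qed

end

text \<open>A positive denominator keeps each exponential small, which bounds \<open>l\<close> and
  \<open>\<zeta>\<close> from below. As it is also below 1, \<open>exp 1 \<le> 3\<close> makes the
  logarithm at least 1, and \<open>sqrt 72\<close> exceeds 8.\<close>

lemma gamma_const_ge:
  assumes d: "1 - 4 * exp (- l\<^sup>2 / 2) - 2 * exp (- \<zeta>\<^sup>2 / 2) > 0"
    and "l > 0" "\<zeta> > 0"
  shows "8 \<le> gamma_const l \<zeta>" and "5 / 2 < l\<^sup>2" and "1 < \<zeta>"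
proof -
  define u v where "u = exp (- l\<^sup>2 / 2)" and "v = exp (- \<zeta>\<^sup>2 / 2)"
  have uv: "0 < u" "0 < v" by (simp_all add: u_def v_def)
  define d where "d = 1 - 4 * u - 2 * v"
  have d0: "0 < d" "d < 1"
    using d uv unfolding d_def by (simp_all only: u_def[symmetric] v_def[symmetric])
  have "1 \<le> ln (3 / d)"
  proof -
    have "exp 1 \<le> 3 / d"
      using d0 by (intro order.trans[OF exp_le]) (simp add: pos_le_divide_eq)
    then show ?thesis using d0 by (simp add: ln_ge_iff)
  qed
  then have "1 \<le> sqrt (ln (3 / d))" by simp
  moreover have "8 \<le> sqrt (72 :: real)" by (rule real_le_rsqrt) simp
  ultimately have "8 * 1 \<le> sqrt 72 * sqrt (ln (3 / d))" by (intro mult_mono) auto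
  then show "8 \<le> gamma_const l \<zeta>" by (simp only: gamma_const_def d_def u_def v_def)
  show "5 / 2 < l\<^sup>2"
  proof (rule ccontr)
    assume "\<not> 5 / 2 < l\<^sup>2"
    then have "exp (- 5 / 4) \<le> u" by (simp add: u_def)
    then have "4 * exp (- 5 / 4) < (1 :: real)"
      using d0(1) uv unfolding d_def by linarith
    then have "4 < exp (5 / 4 :: real)" by (simp add: exp_minus field_simps)
    \<comment> \<open>Fourth powers clear the fraction; the contradiction is that
      \<open>4 ^ 4 = 256\<close> exceeds \<open>3 ^ 5 = 243\<close>.\<close>
    then have "4 ^ 4 < exp (5 / 4 :: real) ^ 4" by (intro power_strict_mono) auto
    also have "\<dots> = exp 1 ^ 5" by (simp only: exp_of_nat_mult[symmetric]) simp
    also have "\<dots> \<le> 3 ^ 5" using exp_le by (intro power_mono) auto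
    finally show False by simp
  qed
  show "1 < \<zeta>"
  proof (rule ccontr)
    assume "\<not> 1 < \<zeta>"
    then have "\<zeta>\<^sup>2 \<le> 1" using assms(3) by (simp add: power_le_one)
    then have "exp (- 1 / 2) \<le> v" by (simp add: v_def)
    then have "2 * exp (- 1 / 2) < (1 :: real)"
      using d0(1) uv unfolding d_def by linarith
    then have "2 < exp (1 / 2 :: real)" by (simp add: exp_minus field_simps)
    then have "2 ^ 2 < exp (1 / 2 :: real) ^ 2" by (intro power_strict_mono) auto
    also have "\<dots> = exp 1" by (simp only: exp_of_nat_mult[symmetric]) simp
    finally show False using exp_le by simp
  qed
qed

section \<open>Subdifferentials contained in a hyperplane\<close>

context subdifferentiable
begin

text \<open>\<open>arg_min_on\<close> is a choice that is meaningful only if a minimiser exists; a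
  nonempty closed set contains a point nearest to the origin.\<close>

lemma arg_min_norm_mem: "arg_min_on norm S \<in> S"
proof -
  obtain z where z: "z \<in> S" "\<And>y. y \<in> S \<Longrightarrow> dist 0 z \<le> dist 0 y"
    using distance_attains_inf[OF closed_S nonempty, of 0] by blast
  show ?thesis
    unfolding arg_min_on_def
    by (rule arg_minI[where Q = "\<lambda>z. z \<in> S" and P = "\<lambda>z. z \<in> S" and f = norm and x = z])
      (use z in \<open>auto simp: not_less\<close>)
qed

context
  fixes z0 :: 'a
  assumes z0: "z0 \<noteq> 0" and S_plane: "\<And>z. z \<in> S \<Longrightarrow> z \<bullet> z0 = z0 \<bullet> z0"
begin

lemma zero_notin_S: "0 \<notin> S"
  using S_plane[of 0] z0 by auto

text \<open>Cauchy-Schwarz against \<open>z0\<close>. For the subgradient of least norm it says that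
  \<open>beta_const f x z0\<close> is at least 1.\<close>

lemma norm_le_of_mem_S:
  assumes "z \<in> S"
  shows "norm z0 \<le> norm z"
proof -
  have "norm z0 * norm z0 = z \<bullet> z0"
    using S_plane[OF assms] by (simp add: power2_norm_eq_inner flip: power2_eq_square)
  also have "\<dots> \<le> norm z * norm z0" by (rule norm_cauchy_schwarz)
  finally show ?thesis using z0 by simp
qed

text \<open>The inequality holds on \<open>S\<close> and survives nonnegative scaling and closure.
  It makes the projected scale nonnegative, so that the deterministic scale is admissible.\<close>

lemma inner_nonneg_of_mem_K:
  assumes "q \<in> K"
  shows "0 \<le> q \<bullet> z0"
proof -
  have "cone_of S \<subseteq> {q. z0 \<bullet> q \<ge> 0}"
    using S_plane by (auto simp: cone_of_def inner_commute)
  then have "K \<subseteq> {q. z0 \<bullet> q \<ge> 0}"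
    unfolding K_def by (rule closure_minimal) (rule closed_halfspace_ge)
  then show ?thesis using assms by (auto simp: inner_commute)
qed

text \<open>A cone point \<open>q = s *\<^sub>R z\<close> has \<open>q \<bullet> u = s * norm z0\<close>, so for \<open>q \<bullet> u < \<tau>\<close> it can be moved
  into \<open>(\<tau> / norm z0) *\<^sub>R S\<close> by adding a nonnegative multiple of \<open>z1\<close>.\<close>

lemma infdist_scaled_le:
  fixes w :: 'a
  defines "u \<equiv> (1 / norm z0) *\<^sub>R z0"
  assumes z1: "z1 \<in> S" and lt: "closest_point K w \<bullet> u < \<tau>"
  shows "infdist w ((*\<^sub>R) (\<tau> / norm z0) ` S)
    \<le> infdist w (cone_of S) + (\<tau> - closest_point K w \<bullet> u) * (norm z1 / norm z0)"
proof -
  interpret closed_convex K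
    using closed_K convex_K K_nonempty by unfold_locales
  have N: "0 < norm z0" using z0 by simp
  have le: "infdist w ((*\<^sub>R) (\<tau> / norm z0) ` S)
      \<le> norm (w - q) + (\<tau> - q \<bullet> u) * (norm z1 / norm z0)"
    if q: "q \<in> cone_of S" "q \<bullet> u < \<tau>" for q
  proof -
    obtain s z where s: "0 \<le> s" "z \<in> S" "q = s *\<^sub>R z"
      using q by (auto simp: cone_of_def)
    have qu: "q \<bullet> u = s * norm z0"
      using s S_plane[OF s(2)] z0
      by (simp add: u_def) (simp add: power2_norm_eq_inner[symmetric] power2_eq_square)
    define t where "t = \<tau> / norm z0"
    have t: "s < t" using q(2) N by (simp add: qu t_def pos_less_divide_eq)
    have t0: "0 < t" using s(1) t by simp
    have "(s / t) *\<^sub>R z + ((t - s) / t) *\<^sub>R z1 \<in> S"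
      using convex_S s z1 t t0 by (intro convexD) (simp_all add: field_simps)
    then have "t *\<^sub>R ((s / t) *\<^sub>R z + ((t - s) / t) *\<^sub>R z1) \<in> (*\<^sub>R) t ` S"
      by (rule imageI)
    moreover have "t *\<^sub>R ((s / t) *\<^sub>R z + ((t - s) / t) *\<^sub>R z1) = q + (t - s) *\<^sub>R z1"
      using t0 s(3) by (simp add: scaleR_right_distrib)
    ultimately have "infdist w ((*\<^sub>R) t ` S) \<le> dist w (q + (t - s) *\<^sub>R z1)"
      by (metis infdist_le)
    also have "\<dots> \<le> norm (w - q) + norm ((t - s) *\<^sub>R z1)"
      unfolding dist_norm using norm_triangle_ineq4[of "w - q" "(t - s) *\<^sub>R z1"] by (simp add: algebra_simps)
    also have "norm ((t - s) *\<^sub>R z1) = (\<tau> - q \<bullet> u) * (norm z1 / norm z0)"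
      using t N by (simp add: qu t_def field_simps)
    finally show ?thesis by (simp add: t_def)
  qed
  \<comment> \<open>\<open>P w\<close> may lie only in the closure of the cone. Nearby cone points
    eventually satisfy the strict inequality, and the bound passes to the limit.\<close>
  obtain q where q: "\<And>n. q n \<in> cone_of S" "q \<longlonglongrightarrow> P w"
    using P_in[of w] unfolding K_def closure_sequential by blast
  have "(\<lambda>n. q n \<bullet> u) \<longlonglongrightarrow> P w \<bullet> u"
    by (intro tendsto_intros q)
  then have "\<forall>\<^sub>F n in sequentially. q n \<bullet> u < \<tau>"
    using lt by (rule order_tendstoD)
  then have "\<forall>\<^sub>F n in sequentially. infdist w ((*\<^sub>R) (\<tau> / norm z0) ` S)
      \<le> norm (w - q n) + (\<tau> - q n \<bullet> u) * (norm z1 / norm z0)"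
    by eventually_elim (use le q(1) in blast)
  moreover have "(\<lambda>n. norm (w - q n) + (\<tau> - q n \<bullet> u) * (norm z1 / norm z0))
      \<longlonglongrightarrow> norm (w - P w) + (\<tau> - P w \<bullet> u) * (norm z1 / norm z0)"
    by (intro tendsto_intros q)
  ultimately have "infdist w ((*\<^sub>R) (\<tau> / norm z0) ` S)
      \<le> norm (w - P w) + (\<tau> - P w \<bullet> u) * (norm z1 / norm z0)"
    by (intro tendsto_lowerbound[OF _ _ sequentially_bot])
  then show ?thesis by (simp add: infdist_cone_of infdist_eq)
qed

end

end

section \<open>Combination of the geometric and the probabilistic estimates\<close>

theorem theorem2:
  fixes f :: "real ^ 'n \<Rightarrow> ereal" and x z0 :: "real ^ 'n"
    and M :: "'w measure" and g :: "'w \<Rightarrow> real ^ 'n"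
    and l \<zeta> :: real
  assumes "proper_fun f" and "convex_fun f"
    and "x \<noteq> 0"
    and "std_gaussian_vector M g"
    and "subdifferential f x \<noteq> {}"
    and "z0 \<noteq> 0"
    and "\<forall>z\<in>subdifferential f x. (z - z0) \<bullet> z0 = 0"
    and "l > 0" and "\<zeta> > 0"
  shows "0 \<le> stat_dim_error M g f x
    \<and> (1 - 4 * exp (- l\<^sup>2 / 2) - 2 * exp (- \<zeta>\<^sup>2 / 2) > 0 \<longrightarrow>
         stat_dim_error M g f x
           \<le> (4 * l * beta_const f x z0 + gamma_const l \<zeta>)
               * gaussian_width M g (descent_cone f x \<inter> cball 0 1)
             + gamma_const l \<zeta> * (\<zeta> + 2 * l * beta_const f x z0)
             + 4 * l\<^sup>2 * (beta_const f x z0)\<^sup>2)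
    \<and> 0 \<le> mean_dist_upper M g f x - gaussian_width M g (descent_cone f x \<inter> cball 0 1)
    \<and> mean_dist_upper M g f x - gaussian_width M g (descent_cone f x \<inter> cball 0 1)
        \<le> 1.6 + 4 * beta_const f x z0"
proof -
  interpret gaussian_vector M g by unfold_locales fact
  interpret subdifferentiable f x by unfold_locales fact+
  have plane: "z \<bullet> z0 = z0 \<bullet> z0" if "z \<in> S" for z
    using assms(7) that by (auto simp: inner_diff_left)
  note geom = \<open>z0 \<noteq> 0\<close> plane
  define z1 where "z1 = arg_min_on norm S"
  have z1: "z1 \<in> S" unfolding z1_def by (rule arg_min_norm_mem)
  define b where "b = beta_const f x z0"
  have b_eq: "b = norm z1 / norm z0" by (simp add: b_def beta_const_def z1_def)
  have b: "1 \<le> b" using norm_le_of_mem_S[OF geom z1] geom(1) by (simp add: b_eq)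

  define \<omega> where "\<omega> = gaussian_width M g (descent_cone f x \<inter> cball 0 1)"
  define G where "G = (\<lambda>w. infdist (g w) (cone_of S))"
  define F where "F = (\<lambda>t w. infdist (g w) ((*\<^sub>R) t ` S))"
  have "0 \<notin> S" using geom by (rule zero_notin_S)
  then have "(SUP y\<in>descent_cone f x \<inter> cball 0 1. y \<bullet> g w) = G w" for w
    unfolding G_def by (rule SUP_descent_cone)
  then have \<omega>: "\<omega> = expectation G"
    by (simp add: \<omega>_def gaussian_width_def)
  have \<omega>_nonneg: "0 \<le> \<omega>"
    unfolding \<omega> G_def by (intro integral_nonneg_AE) (simp add: infdist_nonneg)
  have G_int: "integrable M G" "integrable M (\<lambda>w. (G w)\<^sup>2)"
    unfolding G_def by (rule lipschitz_integrable[OF infdist_lipschitz])+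
  have F_int: "integrable M (F t)" "integrable M (\<lambda>w. (F t w)\<^sup>2)" for t
    unfolding F_def by (rule lipschitz_integrable[OF infdist_lipschitz])+
  have G_nonneg: "0 \<le> G w" and F_nonneg: "0 \<le> F t w" for t w
    by (simp_all add: G_def F_def infdist_nonneg)
  have G_le_F: "G w \<le> F t w" if "0 \<le> t" for t w
    unfolding G_def F_def using that nonempty by (intro infdist_mono) (auto simp: cone_of_def)
  have G_var: "variance G \<le> 2"
    unfolding G_def infdist_cone_of
    by (rule variance_infdist_le[OF closed_K convex_K K_nonempty])
  have F_var: "variance (F t) \<le> 2" for t
    unfolding F_def using closed_S convex_S nonempty
    by (intro variance_infdist_le closed_scaling convex_scaling) auto

  have upper_eq: "stat_dim_upper M g f x = (INF t\<in>{0..}. expectation (\<lambda>w. (F t w)\<^sup>2))"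
    by (simp add: stat_dim_upper_def F_def)
  have mean_eq: "mean_dist_upper M g f x = (INF t\<in>{0..}. expectation (F t))"
    by (simp add: mean_dist_upper_def F_def)
  have dim_eq: "stat_dim M g f x = expectation (\<lambda>w. (G w)\<^sup>2)"
    by (simp add: stat_dim_def G_def)
  have upper_le: "stat_dim_upper M g f x \<le> expectation (\<lambda>w. (F t w)\<^sup>2)" if "0 \<le> t" for t
    unfolding upper_eq using that
    by (intro cINF_lower bdd_belowI2[of _ 0]) auto
  have mean_le: "mean_dist_upper M g f x \<le> expectation (F t)" if "0 \<le> t" for t
    unfolding mean_eq using that
    by (intro cINF_lower bdd_belowI2[of _ 0]) (auto intro!: integral_nonneg_AE simp: F_nonneg)

  have error_nonneg: "0 \<le> stat_dim_error M g f x"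
  proof -
    have "expectation (\<lambda>w. (G w)\<^sup>2) \<le> expectation (\<lambda>w. (F t w)\<^sup>2)" if "0 \<le> t" for t
      using G_int F_int G_le_F[OF that] G_nonneg by (intro integral_mono power_mono)
    then have "stat_dim M g f x \<le> stat_dim_upper M g f x"
      unfolding dim_eq upper_eq by (intro cINF_greatest) auto
    then show ?thesis by (simp add: stat_dim_error_def)
  qed
  have mean_nonneg: "0 \<le> mean_dist_upper M g f x - \<omega>"
  proof -
    have "expectation G \<le> expectation (F t)" if "0 \<le> t" for t
      using G_int F_int G_le_F[OF that] by (intro integral_mono)
    then have "\<omega> \<le> mean_dist_upper M g f x"
      unfolding \<omega> mean_eq by (intro cINF_greatest) auto
    then show ?thesis by simp
  qed

  define u where "u = (1 / norm z0) *\<^sub>R z0"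
  define T where "T = (\<lambda>w. closest_point K (g w) \<bullet> u)"
  interpret K: closed_convex K
    using closed_K convex_K K_nonempty by unfold_locales
  have norm_u: "norm u = 1" using geom(1) by (simp add: u_def)
  have T_lip: "\<bar>closest_point K y \<bullet> u - closest_point K y' \<bullet> u\<bar> \<le> norm (y - y')" for y y'
    using Cauchy_Schwarz_ineq2[of "K.P y - K.P y'" u] K.P_lipschitz[of y y'] norm_u
    by (simp add: inner_diff_left)
  have T_int: "integrable M T" "integrable M (\<lambda>w. (T w)\<^sup>2)"
    unfolding T_def by (rule lipschitz_integrable[OF T_lip])+
  have T_var: "variance T \<le> 2"
    unfolding T_def by (rule variance_closest_point_le[OF closed_K convex_K K_nonempty norm_u])
  have "0 \<le> T w" for w
    using inner_nonneg_of_mem_K[OF geom K.P_in] by (simp add: T_def u_def)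
  then have T_mean: "0 \<le> expectation T"
    by (intro integral_nonneg_AE) simp
  \<comment> \<open>\<open>k\<close> stays free so that each of the two upper bounds can fix its own
    value.\<close>
  have key: "\<exists>t\<ge>0. expectation (F t) - \<omega> \<le> b * (k + 2 / k) + 4 / k" if k: "0 < k" for k
  proof (intro exI conjI)
    define t where "t = (expectation T + k) / norm z0"
    show "0 \<le> t" using T_mean k by (simp add: t_def)
    have "F t w \<le> G w + (expectation T + k - T w) * b" if "T w < expectation T + k" for w
      using infdist_scaled_le[OF geom z1, of "g w" "expectation T + k"] that
      unfolding F_def G_def T_def t_def b_eq u_def by simp
    then show "expectation (F t) - \<omega> \<le> b * (k + 2 / k) + 4 / k"
      unfolding \<omega> using b k
      by (intro expectation_diff_le[OF F_int F_var G_int G_var T_int T_var]) auto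
  qed

  have mean_bound: "mean_dist_upper M g f x - \<omega> \<le> 1.6 + 4 * b"
  proof -
    \<comment> \<open>With \<open>k = 5 / 2\<close> the term \<open>4 / k\<close> is 1.6 and
      \<open>k + 2 / k\<close> is 3.3, below 4.\<close>
    obtain t where t: "0 \<le> t" "expectation (F t) - \<omega> \<le> b * (5 / 2 + 2 / (5 / 2)) + 4 / (5 / 2)"
      using key[of "5 / 2"] by auto
    then show ?thesis using mean_le[OF t(1)] b by simp
  qed

  have error_bound: "stat_dim_error M g f x
      \<le> (4 * l * b + gamma_const l \<zeta>) * \<omega> + gamma_const l \<zeta> * (\<zeta> + 2 * l * b) + 4 * l\<^sup>2 * b\<^sup>2"
    if pos: "1 - 4 * exp (- l\<^sup>2 / 2) - 2 * exp (- \<zeta>\<^sup>2 / 2) > 0"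
  proof -
    define c where "c = gamma_const l \<zeta>"
    have c: "8 \<le> c" and l2: "5 / 2 < l\<^sup>2" and \<zeta>: "1 < \<zeta>"
      using gamma_const_ge[OF pos] assms(8,9) by (simp_all add: c_def)
    have l: "3 / 2 < l"
      using l2 assms(8) by (intro power2_less_imp_less[of "3 / 2" l]) (simp_all add: power2_eq_square)
    obtain t where t: "0 \<le> t" "expectation (F t) - \<omega> \<le> b * (l + 2 / l) + 4 / l"
      using key[OF assms(8)] by blast
    define d where "d = expectation (F t) - \<omega>"
    have d0: "0 \<le> d"
      unfolding d_def \<omega> using integral_mono[OF G_int(1) F_int(1)[of t]] G_le_F[OF t(1)] by simp
    have "2 / l \<le> l" using l2 assms(8) by (simp add: pos_divide_le_eq power2_eq_square)
    then have "b * (l + 2 / l) \<le> b * (2 * l)" using b by (intro mult_left_mono) auto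
    then have d: "d \<le> 2 * l * b + 4 / l" using t(2) unfolding d_def mult.commute[of b "2 * l"] by linarith
    have "stat_dim_error M g f x \<le> expectation (\<lambda>w. (F t w)\<^sup>2) - expectation (\<lambda>w. (G w)\<^sup>2)"
      unfolding stat_dim_error_def dim_eq using upper_le[OF t(1)] by simp
    \<comment> \<open>Second moments are traded for squared means: the variance of
      \<open>F t\<close> is at most 2, that of \<open>G\<close> at least 0.\<close>
    also have "\<dots> \<le> 2 + (expectation (F t))\<^sup>2 - \<omega>\<^sup>2"
    proof -
      have "expectation (\<lambda>w. (F t w)\<^sup>2) \<le> 2 + (expectation (F t))\<^sup>2"
        using F_var[of t] F_int by (subst (asm) variance_eq) auto
      moreover have "\<omega>\<^sup>2 \<le> expectation (\<lambda>w. (G w)\<^sup>2)"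
        using variance_positive[of G] G_int by (subst (asm) variance_eq) (auto simp: \<omega>)
      ultimately show ?thesis by simp
    qed
    also have "\<dots> = 2 * d * \<omega> + (2 + d\<^sup>2)"
      by (simp add: d_def power2_eq_square algebra_simps)
    also have "\<dots> \<le> (4 * l * b + c) * \<omega> + (c * (\<zeta> + 2 * l * b) + 4 * l\<^sup>2 * b\<^sup>2)"
    proof (rule add_mono)
      have "4 / l \<le> 4" using l by (simp add: divide_le_eq)
      then show "2 * d * \<omega> \<le> (4 * l * b + c) * \<omega>"
        using d c by (intro mult_right_mono \<omega>_nonneg) simp
      \<comment> \<open>The cross term of the square is \<open>16 * b\<close>, and 2 plus
        \<open>64 / 10\<close> gives \<open>84 / 10\<close>. Both fit under
        \<open>8 * (\<zeta> + 2 * l * b)\<close> because \<open>\<zeta> > 1\<close>,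
        \<open>l > 3 / 2\<close> and \<open>b \<ge> 1\<close>.\<close>
      have "d\<^sup>2 \<le> (2 * l * b + 4 / l)\<^sup>2" using d d0 by (rule power_mono)
      also have "\<dots> = 4 * l\<^sup>2 * b\<^sup>2 + 16 * b + 16 / l\<^sup>2"
        using assms(8) by (simp add: power2_eq_square field_simps)
      also have "16 / l\<^sup>2 \<le> 64 / 10" using l2 by (simp add: divide_le_eq)
      finally have "2 + d\<^sup>2 \<le> 4 * l\<^sup>2 * b\<^sup>2 + (16 * b + 84 / 10)" by simp
      also have "16 * b + 84 / 10 \<le> 8 * (\<zeta> + 2 * l * b)"
      proof -
        have "3 / 2 * b \<le> l * b" using l b by (intro mult_right_mono) auto
        moreover have "8 * (\<zeta> + 2 * l * b) = 8 * \<zeta> + 16 * (l * b)" by simp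
        ultimately show ?thesis using \<zeta> b by linarith
      qed
      also have "8 * (\<zeta> + 2 * l * b) \<le> c * (\<zeta> + 2 * l * b)"
        using c \<zeta> l b by (intro mult_right_mono) auto
      finally show "2 + d\<^sup>2 \<le> c * (\<zeta> + 2 * l * b) + 4 * l\<^sup>2 * b\<^sup>2" by simp
    qed
    finally show ?thesis by (simp add: c_def algebra_simps)
  qed

  show ?thesis
    using error_nonneg error_bound mean_nonneg mean_bound unfolding \<omega>_def b_def by blast
qed

end
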